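(* Let $d\ge 1$ and $n\ge 2$. Let $\mathcal C_1,\dots,\mathcal C_n$ be entanglement-breaking channels, $\mathcal C_i:L(\mathcal H_i)\to L(\mathcal K_i)$ going from a sender to receiver $B_i$, and let $\mathcal S_1,\dots,\mathcal S_n$ be side-channels, where each $\mathcal S_i:L(\mathbb C^d)\to L(\mathbb C^d)$ is a quantum channel from the sender to $B_i$ acting on a $d$-dimensional system. Then random-receiver quantum communication of a $d$-dimensional message through the channels $(\mathcal C_i\otimes\mathcal S_i)_{i=1}^n$ is possible if and only if every side-channel $\mathcal S_i$, $i=1,\dots,n$, is noiseless.
   Context: All quantum systems are finite-dimensional. $L(\mathcal H)$ denotes the linear operators on $\mathcal H$. A quantum channel is a completely positive trace-preserving linear map. A channel $\mathcal C$ is entanglement-breaking if it has the measure-and-prepare form $\mathcal C(\rho)=\sum_j\operatorname{Tr}[M_j\rho]\,\rho_j$ for some POVM $(M_j)$ and density operators $\rho_j$. A channel on $L(\mathbb C^d)$ is noiseless if it is a unitary channel, $\rho\mapsto U\rho U^\dagger$ with $U$ unitary. Random-receiver quantum communication: the sender must transmit a $d$-dimensional quantum message to receiver $B_x$, one of $n$ spatially separated receivers, where $x\in\{1,\dots,n\}$ is unknown to the sender but known to all receivers. The receivers may use arbitrary (multi-round) local operations and classical communication (LOCC), but no quantum communication among themselves. The task is said to be possible through the channels $(\mathcal C_i\otimes\mathcal S_i)_{i=1}^n$ if there exist an encoding channel $\mathcal E:L(\mathbb C^d)\to L\big(\bigotimes_{i=1}^n(\mathcal H_i\otimes\mathbb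 C^d)\big)$, independent of $x$, and, for every $x\in\{1,\dots,n\}$, an LOCC channel $\Lambda^{(x)}: L\big(\bigotimes_{i=1}^n(\mathcal K_i\otimes\mathbb C^d)\big)\to L(\mathbb C^d)$, such that $$\Lambda^{(x)}\circ\Big(\bigotimes_{i=1}^n(\mathcal C_i\otimes\mathcal S_i)\Big)\circ\mathcal E=\mathcal I_d\qquad\text{for every }x .$$ Here LOCC is with respect to the $n$ parties, party $B_i$ holding $\mathcal K_i\otimes\mathbb C^d$, the output $\mathbb C^d$ of $\Lambda^{(x)}$ is held by $B_x$ and the other parties end with no output, and $\mathcal I_d$ is the identity channel on $L(\mathbb C^d)$. *)

theory Defs
  imports "HOL-Analysis.Analysis" "HOL-Library.FuncSet" "HOL-Library.Infinite_Typeclass"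
begin

text \<open>
  A finite-dimensional system is the Hilbert space with orthonormal basis labelled by a finite
  set \<open>A\<close>; an operator on it is a matrix \<open>X i j\<close> with \<open>i, j \<in> A\<close>, set to 0 outside
  \<open>A \<times> A\<close>. In particular the space of complex \<open>d\<close>-tuples has label set \<open>{..<d}\<close>. Label sets
  rather than index types are used because the dimensions depend on the party.
  The tensor product of two systems has label set \<open>A \<times> B\<close>, and that of a family
  \<open>A i\<close> with \<open>i \<in> I\<close> has label set \<open>PiE I A\<close>.

  Superoperators are HOL functions on matrices; only their values on operators supported on the
  input system are meaningful.
\<close>

type_synonym 'a oper = "'a \<Rightarrow> 'a \<Rightarrow> complex"
type_synonym ('a, 'b) superoper = "'a oper \<Rightarrow> 'b oper"

definition ops :: "'a set \<Rightarrow> 'a oper set" where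
  "ops A = {X. \<forall>i j. i \<notin> A \<or> j \<notin> A \<longrightarrow> X i j = 0}"

definition op_id :: "'a set \<Rightarrow> 'a oper" where
  "op_id A = (\<lambda>i j. of_bool (i \<in> A \<and> i = j))"

definition op_unit :: "'a \<Rightarrow> 'a \<Rightarrow> 'a oper" where
  "op_unit a b = (\<lambda>i j. of_bool (i = a \<and> j = b))"

definition op_mult :: "'a set \<Rightarrow> 'a oper \<Rightarrow> 'a oper \<Rightarrow> 'a oper" where
  "op_mult A X Y = (\<lambda>i j. \<Sum>k\<in>A. X i k * Y k j)"

definition op_adj :: "'a oper \<Rightarrow> 'a oper" where
  "op_adj X = (\<lambda>i j. cnj (X j i))"

definition op_trace :: "'a set \<Rightarrow> 'a oper \<Rightarrow> complex" where
  "op_trace A X = (\<Sum>i\<in>A. X i i)"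

definition psd :: "'a set \<Rightarrow> 'a oper \<Rightarrow> bool" where
  "psd A X \<longleftrightarrow> X \<in> ops A \<and>
     (\<forall>v :: 'a \<Rightarrow> complex. (\<Sum>i\<in>A. \<Sum>j\<in>A. cnj (v i) * X i j * v j) \<in> \<real>\<^sub>\<ge>\<^sub>0)"

definition density :: "'a set \<Rightarrow> 'a oper \<Rightarrow> bool" where
  "density A X \<longleftrightarrow> psd A X \<and> op_trace A X = 1"

definition unitary :: "'a set \<Rightarrow> 'a oper \<Rightarrow> bool" where
  "unitary A U \<longleftrightarrow> U \<in> ops A \<and>
     op_mult A (op_adj U) U = op_id A \<and> op_mult A U (op_adj U) = op_id A"


text \<open>
  Tensor products of superoperators with input systems \<open>A, B\<close>, respectively \<open>A i\<close> for
  \<open>i \<in> I\<close>: the bilinear (multilinear) expansion of the input in matrix units.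
\<close>

definition tensor_map ::
  "'a set \<Rightarrow> 'b set \<Rightarrow> ('a, 'c) superoper \<Rightarrow> ('b, 'd) superoper \<Rightarrow> ('a \<times> 'b, 'c \<times> 'd) superoper" where
  "tensor_map A B \<Phi> \<Psi> X = (\<lambda>(c, d) (c', d').
     \<Sum>a\<in>A. \<Sum>a'\<in>A. \<Sum>b\<in>B. \<Sum>b'\<in>B.
       X (a, b) (a', b') * \<Phi> (op_unit a a') c c' * \<Psi> (op_unit b b') d d')"

definition party_tensor ::
  "'i set \<Rightarrow> ('i \<Rightarrow> 'a set) \<Rightarrow> ('i \<Rightarrow> ('a, 'b) superoper) \<Rightarrow> ('i \<Rightarrow> 'a, 'i \<Rightarrow> 'b) superoper" where
  "party_tensor I A \<Phi> X = (\<lambda>f g.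
     if f \<in> extensional I \<and> g \<in> extensional I
     then \<Sum>p\<in>PiE I A. \<Sum>q\<in>PiE I A. X p q * (\<Prod>i\<in>I. \<Phi> i (op_unit (p i) (q i)) (f i) (g i))
     else 0)"


definition linear_map :: "'a set \<Rightarrow> 'b set \<Rightarrow> ('a, 'b) superoper \<Rightarrow> bool" where
  "linear_map A B \<Phi> \<longleftrightarrow>
     (\<forall>X\<in>ops A. \<Phi> X \<in> ops B) \<and>
     (\<forall>X\<in>ops A. \<forall>Y\<in>ops A. \<Phi> (\<lambda>i j. X i j + Y i j) = (\<lambda>i j. \<Phi> X i j + \<Phi> Y i j)) \<and>
     (\<forall>c. \<forall>X\<in>ops A. \<Phi> (\<lambda>i j. c * X i j) = (\<lambda>i j. c * \<Phi> X i j))"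

definition cp_map :: "'a set \<Rightarrow> 'b set \<Rightarrow> ('a, 'b) superoper \<Rightarrow> bool" where
  "cp_map A B \<Phi> \<longleftrightarrow> linear_map A B \<Phi> \<and>
     (\<forall>m::nat. \<forall>X. psd ({..<m} \<times> A) X \<longrightarrow>
        psd ({..<m} \<times> B) (tensor_map {..<m} A (\<lambda>Y. Y) \<Phi> X))"

definition channel :: "'a set \<Rightarrow> 'b set \<Rightarrow> ('a, 'b) superoper \<Rightarrow> bool" where
  "channel A B \<Phi> \<longleftrightarrow> cp_map A B \<Phi> \<and> (\<forall>X\<in>ops A. op_trace B (\<Phi> X) = op_trace A X)"

definition instrument :: "'a set \<Rightarrow> 'b set \<Rightarrow> nat \<Rightarrow> (nat \<Rightarrow> ('a, 'b) superoper) \<Rightarrow> bool" where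
  "instrument A B m F \<longleftrightarrow> (\<forall>j<m. cp_map A B (F j)) \<and>
     (\<forall>X\<in>ops A. (\<Sum>j<m. op_trace B (F j X)) = op_trace A X)"

definition povm :: "'a set \<Rightarrow> nat \<Rightarrow> (nat \<Rightarrow> 'a oper) \<Rightarrow> bool" where
  "povm A m M \<longleftrightarrow> (\<forall>j<m. psd A (M j)) \<and> (\<forall>a b. (\<Sum>j<m. M j a b) = op_id A a b)"

definition entanglement_breaking :: "'a set \<Rightarrow> 'b set \<Rightarrow> ('a, 'b) superoper \<Rightarrow> bool" where
  "entanglement_breaking A B \<Phi> \<longleftrightarrow> channel A B \<Phi> \<and>
     (\<exists>m M \<rho>. povm A m M \<and> (\<forall>j<m. density B (\<rho> j)) \<and>
        (\<forall>X\<in>ops A. \<Phi> X = (\<lambda>a b. \<Sum>j<m. op_trace A (op_mult A (M j) X) * \<rho> j a b)))"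

definition noiseless :: "'a set \<Rightarrow> ('a, 'a) superoper \<Rightarrow> bool" where
  "noiseless A \<Phi> \<longleftrightarrow> (\<exists>U. unitary A U \<and>
     (\<forall>X\<in>ops A. \<Phi> X = op_mult A (op_mult A U X) (op_adj U)))"


text \<open>
  \<open>locc I A B \<Lambda>\<close>: the superoperator \<open>\<Lambda>\<close> from the systems \<open>A i\<close> to the systems \<open>B i\<close>
  (party \<open>i \<in> I\<close> holding the \<open>i\<close>-th one) is realised by a protocol with finitely many rounds.
  In a round, one party \<open>k\<close> applies an instrument \<open>F\<close> with finitely many outcomes to its
  system, which becomes \<open>A'\<close>, and announces the outcome \<open>j\<close>; everything that follows,
  including the choice of who acts next, may depend on \<open>j\<close>. Finally every party applies a local
  channel. The sort \<open>infinite\<close> guarantees that \<open>'a\<close> has enough labels for intermediate systems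
  of every finite dimension.
\<close>

inductive locc ::
  "'i set \<Rightarrow> ('i \<Rightarrow> 'a::infinite set) \<Rightarrow> ('i \<Rightarrow> 'b set) \<Rightarrow> ('i \<Rightarrow> 'a, 'i \<Rightarrow> 'b) superoper \<Rightarrow> bool"
  for I :: "'i set"
where
  final: "locc I A B \<Lambda>"
    if "\<And>i. i \<in> I \<Longrightarrow> channel (A i) (B i) (T i)"
      and "\<And>X. X \<in> ops (PiE I A) \<Longrightarrow> \<Lambda> X = party_tensor I A T X"
| round: "locc I A B \<Lambda>"
    if "k \<in> I" and "finite A'" and "instrument (A k) A' m F"
      and "\<And>j. j < m \<Longrightarrow> locc I (A(k := A')) B (\<Lambda>' j)"
      and "\<And>X. X \<in> ops (PiE I A) \<Longrightarrow>
             \<Lambda> X = (\<lambda>f g. \<Sum>j<m. \<Lambda>' j (party_tensor I A ((\<lambda>i Y. Y)(k := F j)) X) f g)"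


text \<open>
  No output is the one-dimensional system \<open>{..<1}\<close>; \<open>at_receiver n d x\<close> is the canonical
  identification of operators on \<open>{..<d}\<close> with operators on the joint output system in which
  only receiver \<open>x\<close> has an output.
\<close>

definition output_sys :: "nat \<Rightarrow> nat \<Rightarrow> nat \<Rightarrow> nat set" where
  "output_sys d x i = (if i = x then {..<d} else {..<1})"

definition at_receiver :: "nat \<Rightarrow> nat \<Rightarrow> nat \<Rightarrow> (nat, nat \<Rightarrow> nat) superoper" where
  "at_receiver n d x \<rho> = (\<lambda>f g.
     if f \<in> PiE {1..n} (output_sys d x) \<and> g \<in> PiE {1..n} (output_sys d x)
     then \<rho> (f x) (g x) else 0)"

definition rrqc_possible ::
  "nat \<Rightarrow> nat \<Rightarrow> (nat \<Rightarrow> 'p set) \<Rightarrow> (nat \<Rightarrow> 'q::infinite set) \<Rightarrow> (nat \<Rightarrow> ('p, 'q) superoper) \<Rightarrow> bool"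
where
  "rrqc_possible d n P Q N \<longleftrightarrow>
     (\<exists>E. channel {..<d} (PiE {1..n} P) E \<and>
        (\<forall>x\<in>{1..n}. \<exists>\<Lambda>. locc {1..n} Q (output_sys d x) \<Lambda> \<and>
           (\<forall>\<rho>\<in>ops {..<d}. \<Lambda> (party_tensor {1..n} P N (E \<rho>)) = at_receiver n d x \<rho>)))"

end

theory Submission
  imports Defs "Jordan_Normal_Form.Determinant"
begin

text \<open>
  Necessity: an LOCC protocol is a sum of product Kraus operators, and \<open>C x\<close> has Kraus operators
  of rank one. Hence every Kraus operator of the whole scheme for receiver \<open>x\<close> factors as
  \<open>L S\<^sub>t M\<close> with square matrices, where \<open>S\<^sub>t\<close> is a Kraus operator of the side-channel \<open>S x\<close> and
  \<open>L, M\<close> do not depend on \<open>t\<close>. As these operators sum up to the identity channel, each is scalar,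
  and one is nonzero; so \<open>L\<close> and \<open>M\<close> are invertible, all \<open>S\<^sub>t\<close> are proportional to one matrix, and
  trace preservation makes this matrix a multiple of a unitary.

  Sufficiency: send \<open>\<Sum>\<^sub>a v\<^sub>a |a, \<dots>, a\<rangle>\<close> through the side-channels. All parties but \<open>x\<close> undo their
  unitary and measure in the Fourier basis, which leaves \<open>v\<close> at \<open>x\<close> up to known phases.
\<close>


section \<open>Positive semidefinite matrices\<close>

text \<open>Necessity rests on the message and the side-channel having the same dimension
  \<open>d\<close>. A Kraus operator of \<open>C x\<close> of higher rank could carry part of the
  message next to \<open>S x\<close>, and the matrices around S_t would become rectangular; rank one
  closes that path and squeezes each branch through the \<open>d\<close>-dimensional system of
  \<open>S x\<close>. The label t can be varied with everything else fixed because encoder, channels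
  and protocol get separate Kraus expansions, and the whole scheme is labelled by all tuples of
  their labels. What LOCC contributes is the product form: for fixed labels and a fixed input basis
  vector, every party other than \<open>x\<close> contributes just a number, which is absorbed into
  M. For sufficiency, the Fourier basis is unbiased with respect to the copied basis. An outcome
  therefore reveals nothing about the label a, all outcomes have equal weight, and the only damage
  is a phase depending on a and the announced outcome. These phases multiply over the parties, and
  \<open>x\<close> can undo them.\<close>

definition sesq :: "'a set \<Rightarrow> 'a oper \<Rightarrow> ('a \<Rightarrow> complex) \<Rightarrow> complex" where
  "sesq A X v = (\<Sum>i\<in>A. \<Sum>j\<in>A. cnj (v i) * X i j * v j)"

lemma psd_sesq: "psd A X \<Longrightarrow> sesq A X v \<in> \<real>\<^sub>\<ge>\<^sub>0"
  by (simp add: psd_def sesq_def)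

lemma sesq_support:
  assumes "finite A" "B \<subseteq> A" "\<And>i. i \<in> A - B \<Longrightarrow> v i = 0"
  shows "sesq A X v = sesq B X v"
proof -
  have "(\<Sum>j\<in>A. cnj (v i) * X i j * v j) = (\<Sum>j\<in>B. cnj (v i) * X i j * v j)" for i
    by (rule sum.mono_neutral_right) (use assms in auto)
  then show ?thesis
    unfolding sesq_def
    by (simp, intro sum.mono_neutral_right) (use assms in auto)
qed

lemma sesq_insert:
  assumes "finite A" "a \<notin> A"
  shows "sesq (insert a A) X v = cnj (v a) * X a a * v a + cnj (v a) * (\<Sum>j\<in>A. X a j * v j)
    + (\<Sum>i\<in>A. cnj (v i) * X i a) * v a + sesq A X v"
  using assms
  by (simp add: sesq_def sum.distrib sum_distrib_left sum_distrib_right algebra_simps)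

lemma psd_diag:
  assumes "psd A X" "finite A" "a \<in> A"
  shows "X a a \<in> \<real>\<^sub>\<ge>\<^sub>0"
proof -
  have "sesq A X (\<lambda>k. of_bool (k = a)) = sesq {a} X (\<lambda>k. of_bool (k = a))"
    by (rule sesq_support) (use assms in auto)
  also have "\<dots> = X a a"
    by (simp add: sesq_def)
  finally show ?thesis
    using psd_sesq[OF assms(1)] by metis
qed

lemma psd_pair:
  assumes "psd A X" "finite A" "a \<in> A" "b \<in> A" "a \<noteq> b"
  shows "cnj s * X a a * s + cnj s * X a b * t + cnj t * X b a * s + cnj t * X b b * t \<in> \<real>\<^sub>\<ge>\<^sub>0"
proof -
  let ?v = "\<lambda>k. if k = a then s else if k = b then t else 0"
  have "sesq A X ?v = sesq {a, b} X ?v"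
    by (rule sesq_support) (use assms in auto)
  also have "\<dots> = cnj s * X a a * s + cnj s * X a b * t + cnj t * X b a * s + cnj t * X b b * t"
    using assms by (simp add: sesq_def)
  finally show ?thesis
    using psd_sesq[OF assms(1)] by metis
qed

text \<open>The form is real at e_a + e_b and at e_a + i e_b; since the diagonal is real, this
  determines \<open>X b a\<close> from \<open>X a b\<close>.\<close>

lemma psd_hermitian:
  assumes "psd A X" "finite A" "a \<in> A" "b \<in> A"
  shows "X b a = cnj (X a b)"
proof (cases "a = b")
  case True
  then show ?thesis
    using psd_diag[OF assms(1-3)] by (simp add: complex_nonneg_Reals_iff complex_eq_iff)
next
  case False
  note d = psd_diag[OF assms(1-3)] psd_diag[OF assms(1,2,4)]
  show ?thesis
    using psd_pair[OF assms False, of 1 1] psd_pair[OF assms False, of 1 \<i>] d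
    by (simp add: complex_nonneg_Reals_iff complex_eq_iff)
qed

text \<open>With z = \<open>X a b\<close>, the form at the vector with entries s z at
  \<open>a\<close> and 1 at \<open>b\<close> is affine in the real number s with slope 2 |z|^2. It
  stays nonnegative for all s only if z = 0.\<close>

lemma psd_null_row:
  assumes "psd A X" "finite A" "a \<in> A" "b \<in> A" "X a a = 0"
  shows "X a b = 0"
proof (cases "a = b")
  case False
  let ?z = "X a b" and ?c = "Re (X b b)"
  have "Re (cnj (of_real s * ?z) * X a a * (of_real s * ?z) + cnj (of_real s * ?z) * X a b * 1 + cnj 1 * X b a * (of_real s * ?z) + cnj 1 * X b b * 1) \<ge> 0" for s
    using psd_pair[OF assms(1-4) False, of "of_real s * ?z" 1] by (simp add: complex_nonneg_Reals_iff)
  then have "2 * s * (cmod ?z)\<^sup>2 + ?c \<ge> 0" for s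
    using assms(5) psd_hermitian[OF assms(1-4)]
    by (simp add: cmod_power2, simp add: power2_eq_square algebra_simps)
  from this[of "- (1 + \<bar>?c\<bar>) / (cmod ?z)\<^sup>2"] show ?thesis
    by (cases "?z = 0") auto
qed (use assms in auto)

text \<open>
  Cholesky elimination of one index at a time. A vanishing pivot \<open>X a a\<close> needs no case distinction:
  its row vanishes, and so does the division by it.
\<close>

lemma psd_rank_one_sum:
  assumes "finite A" "psd A X"
  shows "\<exists>m v. \<forall>i\<in>A. \<forall>j\<in>A. X i j = (\<Sum>r<m::nat. v r i * cnj (v r j))"
  using assms
proof (induction A arbitrary: X rule: finite_induct)
  case empty
  then show ?case by simp
next
  case (insert a A)
  let ?B = "insert a A"
  have fin: "finite ?B" using insert by simp
  have herm: "X j i = cnj (X i j)" if "i \<in> ?B" "j \<in> ?B" for i j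
    using psd_hermitian[OF insert.prems fin] that by blast
  define Y where "Y = (\<lambda>i j. if i \<in> A \<and> j \<in> A then X i j - X i a * X a j / X a a else 0)"
  have row0: "X a j = 0" if "X a a = 0" "j \<in> ?B" for j
    using psd_null_row[OF insert.prems fin, of a j] that by simp
  have "psd A Y"
  proof -
    have "sesq A Y v \<in> \<real>\<^sub>\<ge>\<^sub>0" for v
    proof -
      let ?s = "\<Sum>j\<in>A. X a j * v j" and ?t = "\<Sum>i\<in>A. cnj (v i) * X i a"
      \<comment> \<open>This entry at \<open>a\<close> completes the square, so the form of
        \<open>X\<close> at \<open>?w\<close> is the form of the Schur complement \<open>Y\<close>
        at \<open>v\<close>.\<close>
      let ?w = "v(a := - ?s / X a a)"
      have "?t = cnj ?s"
        using herm[of a] by (simp add: mult.commute)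
      have Xaa: "cnj (X a a) = X a a" using herm[of a a] by simp
      have s0: "?s = 0" if "X a a = 0" using row0[OF that] by simp
      have "sesq A X ?w = sesq A X v" "(\<Sum>j\<in>A. X a j * ?w j) = ?s"
        "(\<Sum>i\<in>A. cnj (?w i) * X i a) = ?t"
        using insert.hyps by (auto simp: sesq_def intro!: sum.cong)
      then have "sesq ?B X ?w = cnj (- ?s / X a a) * X a a * (- ?s / X a a)
          + cnj (- ?s / X a a) * ?s + ?t * (- ?s / X a a) + sesq A X v"
        using sesq_insert[OF insert.hyps, of X ?w] by simp
      also have "\<dots> = sesq A X v - ?t * ?s / X a a"
        unfolding \<open>?t = cnj ?s\<close> complex_cnj_divide complex_cnj_minus Xaa
        using s0 by (cases "X a a = 0") (simp_all add: field_simps)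
      also have "?t * ?s / X a a
          = (\<Sum>i\<in>A. \<Sum>j\<in>A. cnj (v i) * (X i a * X a j / X a a) * v j)"
        by (simp add: sum_product sum_divide_distrib mult.assoc)
      also have "sesq A X v - \<dots> = sesq A Y v"
        by (simp add: sesq_def Y_def sum_subtractf left_diff_distrib right_diff_distrib
            cong: sum.cong)
      finally show ?thesis using psd_sesq[OF insert.prems] by metis
    qed
    then show ?thesis
      by (auto simp: psd_def ops_def sesq_def Y_def)
  qed
  then obtain m v where v: "\<forall>i\<in>A. \<forall>j\<in>A. Y i j = (\<Sum>r<m::nat. v r i * cnj (v r j))"
    using insert.IH by blast
  \<comment> \<open>The new vector, with index \<open>m\<close>, is column \<open>a\<close> over the
    square root of the pivot; the vectors obtained for \<open>Y\<close> are extended by 0 at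
    \<open>a\<close>.\<close>
  define w where "w = (\<lambda>r i. if r = m then X i a / of_real (sqrt (Re (X a a)))
      else if i = a then 0 else v r i)"
  have real: "X a a = of_real (Re (X a a))" "Re (X a a) \<ge> 0"
    using psd_diag[OF insert.prems fin, of a] by (auto simp: complex_nonneg_Reals_iff complex_eq_iff)
  have sq: "X i a / of_real (sqrt (Re (X a a))) * cnj (X j a / of_real (sqrt (Re (X a a))))
      = X i a * X a j / X a a" if "i \<in> ?B" "j \<in> ?B" for i j
  proof -
    have "of_real (sqrt (Re (X a a))) * of_real (sqrt (Re (X a a))) = X a a"
      using real by (metis of_real_mult real_sqrt_mult_self abs_of_nonneg)
    then show ?thesis
      using herm[of j a] that by (simp add: )
  qed
  have "X i j = (\<Sum>r<Suc m. w r i * cnj (w r j))" if ij: "i \<in> ?B" "j \<in> ?B" for i j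
  proof -
    have "(\<Sum>r<m. w r i * cnj (w r j)) = (if i \<in> A \<and> j \<in> A then Y i j else 0)"
      using v insert.hyps ij by (auto simp: w_def intro!: sum.cong)
    then have "(\<Sum>r<Suc m. w r i * cnj (w r j))
        = (if i \<in> A \<and> j \<in> A then Y i j else 0) + X i a * X a j / X a a"
      using sq[OF ij] by (simp add: w_def)
    also have "\<dots> = X i j"
      using ij insert.hyps row0 herm[of i a] herm[of a i] by (auto simp: Y_def)
    finally show ?thesis by simp
  qed
  then show ?case by blast
qed


section \<open>Kraus representations\<close>

text \<open>Kraus form, with the output label before the input label. \<open>J\<close> is an
  arbitrary set because tensor products and compositions are indexed by pairs or functions. Cutting
  off outside \<open>B\<close> makes equalities of superoperator values hold as equalities of
  functions.\<close>

definition kmap ::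
  "'a set \<Rightarrow> 'b set \<Rightarrow> 'j set \<Rightarrow> ('j \<Rightarrow> 'b \<Rightarrow> 'a \<Rightarrow> complex) \<Rightarrow> ('a, 'b) superoper" where
  "kmap A B J K X = (\<lambda>b b'. if b \<in> B \<and> b' \<in> B
     then \<Sum>j\<in>J. \<Sum>a\<in>A. \<Sum>a'\<in>A. K j b a * X a a' * cnj (K j b' a') else 0)"

lemma op_unit_ops: "a \<in> A \<Longrightarrow> a' \<in> A \<Longrightarrow> op_unit a a' \<in> ops A"
  by (auto simp: op_unit_def ops_def)

lemma op_unit_sum:
  assumes "finite A" "X \<in> ops A"
  shows "X = (\<lambda>i j. \<Sum>s\<in>A \<times> A. X (fst s) (snd s) * op_unit (fst s) (snd s) i j)"
proof (intro ext)
  fix i j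
  have "(\<Sum>s\<in>A \<times> A. X (fst s) (snd s) * op_unit (fst s) (snd s) i j)
      = (\<Sum>s\<in>A \<times> A. if s = (i, j) then X i j else 0)"
    by (intro sum.cong) (auto simp: op_unit_def)
  also have "\<dots> = X i j"
    using assms by (auto simp: ops_def)
  finally show "X i j = (\<Sum>s\<in>A \<times> A. X (fst s) (snd s) * op_unit (fst s) (snd s) i j)" ..
qed

lemma linear_map_ops: "linear_map A B \<Phi> \<Longrightarrow> X \<in> ops A \<Longrightarrow> \<Phi> X \<in> ops B"
  by (simp add: linear_map_def)

lemma linear_map_scale:
  "linear_map A B \<Phi> \<Longrightarrow> X \<in> ops A \<Longrightarrow> \<Phi> (\<lambda>i j. c * X i j) = (\<lambda>i j. c * \<Phi> X i j)"
  unfolding linear_map_def by (elim conjE) blast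

lemma linear_map_add:
  "linear_map A B \<Phi> \<Longrightarrow> X \<in> ops A \<Longrightarrow> Y \<in> ops A \<Longrightarrow>
    \<Phi> (\<lambda>i j. X i j + Y i j) = (\<lambda>i j. \<Phi> X i j + \<Phi> Y i j)"
  unfolding linear_map_def by (elim conjE) blast

lemma linear_map_sum:
  assumes "linear_map A B \<Phi>" "finite S" "\<And>s. s \<in> S \<Longrightarrow> Y s \<in> ops A"
  shows "\<Phi> (\<lambda>i j. \<Sum>s\<in>S. c s * Y s i j) = (\<lambda>i j. \<Sum>s\<in>S. c s * \<Phi> (Y s) i j)"
  using assms(2,3)
proof (induction S rule: finite_induct)
  case empty
  have "(\<lambda>i j. 0) \<in> ops A" by (simp add: ops_def)
  then have "\<Phi> (\<lambda>i j. 0 * 0) = (\<lambda>i j. 0 * \<Phi> (\<lambda>i j. 0) i j)"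
    using linear_map_scale[OF assms(1)] by blast
  then show ?case by simp
next
  case (insert s S)
  have "(\<lambda>i j. c s * Y s i j) \<in> ops A" "(\<lambda>i j. \<Sum>s\<in>S. c s * Y s i j) \<in> ops A"
    using insert.prems by (simp_all add: ops_def)
  then have "\<Phi> (\<lambda>i j. c s * Y s i j + (\<Sum>s\<in>S. c s * Y s i j))
      = (\<lambda>i j. \<Phi> (\<lambda>i j. c s * Y s i j) i j + \<Phi> (\<lambda>i j. \<Sum>s\<in>S. c s * Y s i j) i j)"
    by (rule linear_map_add[OF assms(1)])
  moreover have "\<Phi> (\<lambda>i j. c s * Y s i j) = (\<lambda>i j. c s * \<Phi> (Y s) i j)"
    using linear_map_scale[OF assms(1)] insert.prems by blast
  ultimately show ?case
    using insert by simp
qed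

lemma linear_map_expand:
  assumes "linear_map A B \<Phi>" "finite A" "X \<in> ops A"
  shows "\<Phi> X b b' = (\<Sum>a\<in>A. \<Sum>a'\<in>A. X a a' * \<Phi> (op_unit a a') b b')"
proof -
  have "\<Phi> X = \<Phi> (\<lambda>i j. \<Sum>s\<in>A \<times> A. X (fst s) (snd s) * op_unit (fst s) (snd s) i j)"
    using op_unit_sum[OF assms(2,3)] by simp
  also have "\<dots> = (\<lambda>i j. \<Sum>s\<in>A \<times> A. X (fst s) (snd s) * \<Phi> (op_unit (fst s) (snd s)) i j)"
    by (intro linear_map_sum[OF assms(1)]) (use assms(2) in \<open>auto intro: op_unit_ops\<close>)
  finally show ?thesis
    by (simp add: sum.cartesian_product split_def)
qed

lemma kmap_ops: "kmap A B J K X \<in> ops B"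
  by (auto simp: kmap_def ops_def)

lemma kmap_linear: "linear_map A B (kmap A B J K)"
  unfolding linear_map_def
proof (intro conjI ballI allI)
qed (auto simp: kmap_ops, auto simp: kmap_def fun_eq_iff sum.distrib sum_distrib_left algebra_simps)

lemma kmap_unit:
  assumes "finite A" "a \<in> A" "a' \<in> A" "b \<in> B" "b' \<in> B"
  shows "kmap A B J K (op_unit a a') b b' = (\<Sum>j\<in>J. K j b a * cnj (K j b' a'))"
proof -
  have "(\<Sum>x\<in>A. \<Sum>y\<in>A. K j b x * op_unit a a' x y * cnj (K j b' y))
      = (\<Sum>x\<in>A. if x = a then \<Sum>y\<in>A. if y = a' then K j b x * cnj (K j b' y) else 0 else 0)" for j
    by (intro sum.cong refl) (auto simp: op_unit_def intro!: sum.cong)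
  then show ?thesis
    using assms by (simp add: kmap_def)
qed

text \<open>A linear map is determined by its values on matrix units, where the Kraus sum collapses
  to one term per Kraus operator. All later Kraus representations are verified through this
  criterion.\<close>

lemma kmap_eqI:
  assumes "linear_map A B \<Phi>" "finite A"
    and "\<And>a a' b b'. \<lbrakk>a \<in> A; a' \<in> A; b \<in> B; b' \<in> B\<rbrakk> \<Longrightarrow>
      \<Phi> (op_unit a a') b b' = (\<Sum>j\<in>J. K j b a * cnj (K j b' a'))"
    and "X \<in> ops A"
  shows "\<Phi> X = kmap A B J K X"
proof (intro ext)
  fix b b'
  show "\<Phi> X b b' = kmap A B J K X b b'"
  proof (cases "b \<in> B \<and> b' \<in> B")
    case True
    then show ?thesis
      unfolding linear_map_expand[OF assms(1,2,4)] linear_map_expand[OF kmap_linear assms(2,4)]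
      by (intro sum.cong refl) (simp add: assms(2,3) kmap_unit)
  next
    case False
    then show ?thesis
      using linear_map_ops[OF assms(1,4)] kmap_ops[of A B J K X] by (auto simp: ops_def)
  qed
qed

text \<open>The form of the image at \<open>v\<close> is the sum over r of the forms of
  \<open>X\<close> at \<open>?u r\<close>, the adjoint of the r-th Kraus operator applied to
  \<open>v\<close>. The chain of sum exchanges only brings these inner sums together.\<close>

lemma psd_kmap:
  assumes "psd A X"
  shows "psd B (kmap A B J K X)"
proof -
  have "(\<Sum>i\<in>B. \<Sum>j\<in>B. cnj (v i) * kmap A B J K X i j * v j) \<in> \<real>\<^sub>\<ge>\<^sub>0" for v
  proof -
    let ?u = "\<lambda>r a. \<Sum>b\<in>B. cnj (K r b a) * v b"
    have "(\<Sum>i\<in>B. \<Sum>j\<in>B. cnj (v i) * kmap A B J K X i j * v j)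
       = (\<Sum>i\<in>B. \<Sum>j\<in>B. \<Sum>r\<in>J. \<Sum>a\<in>A. \<Sum>a'\<in>A. cnj (v i) * (K r i a * X a a' * cnj (K r j a')) * v j)"
      by (simp add: kmap_def sum_distrib_left sum_distrib_right cong: sum.cong)
    also have "\<dots> = (\<Sum>i\<in>B. \<Sum>r\<in>J. \<Sum>j\<in>B. \<Sum>a\<in>A. \<Sum>a'\<in>A. cnj (v i) * (K r i a * X a a' * cnj (K r j a')) * v j)"
      by (intro sum.cong refl sum.swap)
    also have "\<dots> = (\<Sum>r\<in>J. \<Sum>i\<in>B. \<Sum>j\<in>B. \<Sum>a\<in>A. \<Sum>a'\<in>A. cnj (v i) * (K r i a * X a a' * cnj (K r j a')) * v j)"
      by (rule sum.swap)
    also have "\<dots> = (\<Sum>r\<in>J. \<Sum>i\<in>B. \<Sum>a\<in>A. \<Sum>j\<in>B. \<Sum>a'\<in>A. cnj (v i) * (K r i a * X a a' * cnj (K r j a')) * v j)"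
      by (intro sum.cong refl sum.swap)
    also have "\<dots> = (\<Sum>r\<in>J. \<Sum>a\<in>A. \<Sum>i\<in>B. \<Sum>j\<in>B. \<Sum>a'\<in>A. cnj (v i) * (K r i a * X a a' * cnj (K r j a')) * v j)"
      by (intro sum.cong refl sum.swap)
    also have "\<dots> = (\<Sum>r\<in>J. \<Sum>a\<in>A. \<Sum>i\<in>B. \<Sum>a'\<in>A. \<Sum>j\<in>B. cnj (v i) * (K r i a * X a a' * cnj (K r j a')) * v j)"
      by (intro sum.cong refl sum.swap)
    also have "\<dots> = (\<Sum>r\<in>J. \<Sum>a\<in>A. \<Sum>a'\<in>A. \<Sum>i\<in>B. \<Sum>j\<in>B. cnj (v i) * (K r i a * X a a' * cnj (K r j a')) * v j)"
      by (intro sum.cong refl sum.swap)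
    also have "\<dots> = (\<Sum>r\<in>J. sesq A X (?u r))"
    proof (unfold sesq_def, intro sum.cong refl)
      fix r a a'
      have "(\<Sum>i\<in>B. \<Sum>j\<in>B. cnj (v i) * (K r i a * X a a' * cnj (K r j a')) * v j)
          = (\<Sum>i\<in>B. \<Sum>j\<in>B. (cnj (v i) * K r i a) * (cnj (K r j a') * v j)) * X a a'"
        by (simp add: sum_distrib_left sum_distrib_right mult_ac)
      also have "\<dots> = (\<Sum>i\<in>B. cnj (v i) * K r i a) * ?u r a' * X a a'"
        by (simp only: sum_product)
      also have "(\<Sum>i\<in>B. cnj (v i) * K r i a) = cnj (?u r a)"
        by (simp add: mult.commute)
      also have "cnj (?u r a) * ?u r a' * X a a' = cnj (?u r a) * X a a' * ?u r a'"
        by (simp only: mult_ac)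
      finally show "(\<Sum>i\<in>B. \<Sum>j\<in>B. cnj (v i) * (K r i a * X a a' * cnj (K r j a')) * v j)
          = cnj (?u r a) * X a a' * ?u r a'" .
    qed
    also have "\<dots> \<in> \<real>\<^sub>\<ge>\<^sub>0"
      using psd_sesq[OF assms] by (simp add: complex_nonneg_Reals_iff sum_nonneg)
    finally show ?thesis .
  qed
  then show ?thesis by (simp add: psd_def kmap_ops)
qed

lemma psd_rank_one: "psd A (\<lambda>i j. if i \<in> A \<and> j \<in> A then w i * cnj (w j) else 0)"
proof -
  have "(\<Sum>i\<in>A. \<Sum>j\<in>A. cnj (v i) * (w i * cnj (w j)) * v j)
      = (\<Sum>i\<in>A. cnj (v i) * w i) * cnj (\<Sum>i\<in>A. cnj (v i) * w i)" for v :: "'a \<Rightarrow> complex"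
  proof -
    have "cnj (\<Sum>i\<in>A. cnj (v i) * w i) = (\<Sum>i\<in>A. cnj (w i) * v i)"
      by (simp add: mult.commute)
    then show ?thesis by (simp add: sum_product mult.assoc)
  qed
  moreover have "z * cnj z \<in> \<real>\<^sub>\<ge>\<^sub>0" for z
    by (simp add: complex_mult_cnj complex_nonneg_Reals_iff)
  ultimately have "(\<Sum>i\<in>A. \<Sum>j\<in>A. cnj (v i) * (w i * cnj (w j)) * v j) \<in> \<real>\<^sub>\<ge>\<^sub>0" for v
    by presburger
  then show ?thesis
    by (auto simp: psd_def ops_def cong: sum.cong)
qed

lemma tensor_map_left_id:
  assumes "finite A" "finite B" "linear_map B D \<Phi>" "X \<in> ops (A \<times> B)"
  shows "tensor_map A B (\<lambda>Y. Y) \<Phi> X (i, c) (i', c') = \<Phi> (\<lambda>b b'. X (i, b) (i', b')) c c'"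
proof -
  let ?T = "\<lambda>a a'. \<Sum>b\<in>B. \<Sum>b'\<in>B. X (a, b) (a', b') * op_unit a a' i i' * \<Phi> (op_unit b b') c c'"
  have ops: "(\<lambda>b b'. X (i, b) (i', b')) \<in> ops B"
    using assms(4) by (auto simp: ops_def)
  have "tensor_map A B (\<lambda>Y. Y) \<Phi> X (i, c) (i', c')
      = (\<Sum>a\<in>A. if a = i then \<Sum>a'\<in>A. if a' = i' then ?T a a' else 0 else 0)"
    unfolding tensor_map_def prod.case
    by (intro sum.cong refl) (auto simp: op_unit_def intro!: sum.cong)
  also have "\<dots> = \<Phi> (\<lambda>b b'. X (i, b) (i', b')) c c'"
    using assms linear_map_expand[OF assms(3,2) ops, of c c']
    by (auto simp: op_unit_def ops_def sum.delta)
  finally show ?thesis .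
qed

lemma sum_Times_pick:
  assumes "finite M" "i \<in> M" "\<And>k a. k \<noteq> i \<Longrightarrow> f (k, a) = 0"
  shows "(\<Sum>x\<in>M \<times> A. f x) = (\<Sum>a\<in>A. f (i, a))"
proof -
  have "(\<Sum>x\<in>M \<times> A. f x) = (\<Sum>k\<in>M. \<Sum>a\<in>A. f (k, a))"
    by (simp add: sum.cartesian_product)
  also have "\<dots> = (\<Sum>k\<in>{i}. \<Sum>a\<in>A. f (k, a))"
    using assms by (intro sum.mono_neutral_right) auto
  finally show ?thesis by simp
qed

text \<open>Extending by an identity gives another Kraus map, whose operators \<open>?L\<close> are
  the identity tensored with \<open>K j\<close>; so plain positivity of Kraus maps suffices.\<close>

lemma kmap_cp:
  assumes "finite A"
  shows "cp_map A B (kmap A B J K)"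
proof -
  have "psd ({..<m} \<times> B) (tensor_map {..<m} A (\<lambda>Y. Y) (kmap A B J K) X)"
    if "psd ({..<m::nat} \<times> A) X" for m X
  proof -
    have X: "X \<in> ops ({..<m} \<times> A)"
      using that by (simp add: psd_def)
    let ?L = "\<lambda>j c a. of_bool (fst c = fst a) * K j (snd c) (snd a)"
    have "tensor_map {..<m} A (\<lambda>Y. Y) (kmap A B J K) X = kmap ({..<m} \<times> A) ({..<m} \<times> B) J ?L X"
    proof (intro ext)
      fix x y :: "nat \<times> 'b"
      obtain i c where x: "x = (i, c)" by (cases x)
      obtain i' c' where y: "y = (i', c')" by (cases y)
      let ?Y = "\<lambda>b b'. X (i, b) (i', b')"
      have "kmap A B J K ?Y c c' = kmap ({..<m} \<times> A) ({..<m} \<times> B) J ?L X (i, c) (i', c')"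
      proof (cases "i < m \<and> i' < m")
        case True
        have "(\<Sum>a\<in>{..<m} \<times> A. \<Sum>a'\<in>{..<m} \<times> A. ?L j (i, c) a * X a a' * cnj (?L j (i', c') a'))
            = (\<Sum>a\<in>A. \<Sum>a'\<in>A. K j c a * ?Y a a' * cnj (K j c' a'))" for j
        proof -
          have "(\<Sum>a'\<in>{..<m} \<times> A. ?L j (i, c) x * X x a' * cnj (?L j (i', c') a'))
              = (\<Sum>a'\<in>A. ?L j (i, c) x * X x (i', a') * cnj (?L j (i', c') (i', a')))" for x
            using True by (intro sum_Times_pick) auto
          moreover have "(\<Sum>x\<in>{..<m} \<times> A. \<Sum>a'\<in>A. ?L j (i, c) x * X x (i', a') * cnj (?L j (i', c') (i', a')))
              = (\<Sum>a\<in>A. \<Sum>a'\<in>A. ?L j (i, c) (i, a) * X (i, a) (i', a') * cnj (?L j (i', c') (i', a')))"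
            using True by (intro sum_Times_pick) auto
          ultimately show ?thesis by simp
        qed
        then show ?thesis
          using True by (simp add: kmap_def)
      next
        case False
        then have "?Y = (\<lambda>b b'. 0)" using X by (auto simp: ops_def)
        then show ?thesis
          using False by (auto simp: kmap_def)
      qed
      then show "tensor_map {..<m} A (\<lambda>Y. Y) (kmap A B J K) X x y
          = kmap ({..<m} \<times> A) ({..<m} \<times> B) J ?L X x y"
        unfolding x y tensor_map_left_id[OF finite_lessThan assms kmap_linear X] .
    qed
    then show ?thesis by (simp only: psd_kmap[OF that])
  qed
  then show ?thesis by (simp add: cp_map_def kmap_linear)
qed

text \<open>Choi: apply \<open>\<Phi>\<close> to half of the maximally entangled operator \<open>W\<close> and decompose the result.\<close>

lemma cp_kraus:
  assumes "cp_map A B \<Phi>" "finite A" "finite B"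
  shows "\<exists>m K. \<forall>X\<in>ops A. \<Phi> X = kmap A B {..<m::nat} K X"
proof -
  let ?n = "card A"
  obtain e where e: "bij_betw e {..<?n} A"
    using ex_bij_betw_nat_finite[OF assms(2)] atLeast0LessThan by metis
  have lin: "linear_map A B \<Phi>" using assms(1) by (simp add: cp_map_def)
  \<comment> \<open>\<open>cp_map\<close> labels its ancilla by naturals, so \<open>e\<close>
    identifies these with \<open>A\<close>. Block (k, l) of \<open>W\<close> is then the matrix unit
    at \<open>e k\<close>, \<open>e l\<close>, and block (k, l) of the image is the value of
    \<open>\<Phi>\<close> on that unit.\<close>
  define W where "W = (\<lambda>x y. if x \<in> {..<?n} \<times> A \<and> y \<in> {..<?n} \<times> A
     then of_bool (snd x = e (fst x)) * cnj (of_bool (snd y = e (fst y))) else (0::complex))"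
  have psdW: "psd ({..<?n} \<times> A) W"
    unfolding W_def by (rule psd_rank_one)
  then have WO: "W \<in> ops ({..<?n} \<times> A)" by (simp add: psd_def)
  have "psd ({..<?n} \<times> B) (tensor_map {..<?n} A (\<lambda>Y. Y) \<Phi> W)"
    using assms(1) psdW by (simp add: cp_map_def)
  then obtain m v where v: "\<forall>x\<in>{..<?n} \<times> B. \<forall>y\<in>{..<?n} \<times> B.
      tensor_map {..<?n} A (\<lambda>Y. Y) \<Phi> W x y = (\<Sum>r<m::nat. v r x * cnj (v r y))"
    using psd_rank_one_sum[of "{..<?n} \<times> B" "tensor_map {..<?n} A (\<lambda>Y. Y) \<Phi> W"] assms(3) by auto
  let ?e' = "inv_into {..<?n} e"
  \<comment> \<open>A vector of the rank-one decomposition, reshaped into a matrix, is a Kraus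
    operator.\<close>
  define K where "K = (\<lambda>r c a. v r (?e' a, c))"
  have "\<Phi> (op_unit a a') b b' = (\<Sum>j<m. K j b a * cnj (K j b' a'))"
    if "a \<in> A" "a' \<in> A" "b \<in> B" "b' \<in> B" for a a' b b'
  proof -
    have inv: "?e' a < ?n" "?e' a' < ?n" "e (?e' a) = a" "e (?e' a') = a'"
      using e that inv_into_into[of _ e "{..<?n}"] f_inv_into_f[of _ e "{..<?n}"]
      by (auto simp: bij_betw_def)
    have "(\<lambda>b b'. W (?e' a, b) (?e' a', b')) = op_unit a a'"
      using inv that by (auto simp: W_def op_unit_def fun_eq_iff)
    then have "\<Phi> (op_unit a a') b b'
        = tensor_map {..<?n} A (\<lambda>Y. Y) \<Phi> W (?e' a, b) (?e' a', b')"
      using tensor_map_left_id[OF _ assms(2) lin WO] by simp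
    then show ?thesis
      using v inv that by (simp add: K_def)
  qed
  then show ?thesis
    using kmap_eqI[OF lin assms(2)] by blast
qed

lemma kmap_outside: "\<not> (b \<in> B \<and> b' \<in> B) \<Longrightarrow> kmap A B J K X b b' = 0"
  by (simp only: kmap_def if_False)

lemma linear_map_comp:
  assumes "linear_map A B \<Phi>" "linear_map B C \<Psi>"
  shows "linear_map A C (\<lambda>X. \<Psi> (\<Phi> X))"
  unfolding linear_map_def
proof (intro conjI ballI allI)
  fix X Y c assume X: "X \<in> ops A" and Y: "Y \<in> ops A"
  note ops = linear_map_ops[OF assms(1)]
  show "\<Psi> (\<Phi> (\<lambda>i j. X i j + Y i j)) = (\<lambda>i j. \<Psi> (\<Phi> X) i j + \<Psi> (\<Phi> Y) i j)"
    by (simp only: linear_map_add[OF assms(1) X Y] linear_map_add[OF assms(2) ops[OF X] ops[OF Y]])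
next
  fix X c assume X: "X \<in> ops A"
  note ops = linear_map_ops[OF assms(1) X]
  show "\<Psi> (\<Phi> X) \<in> ops C"
    using linear_map_ops[OF assms(2) ops] .
  show "\<Psi> (\<Phi> (\<lambda>i j. c * X i j)) = (\<lambda>i j. c * \<Psi> (\<Phi> X) i j)"
    by (simp only: linear_map_scale[OF assms(1) X] linear_map_scale[OF assms(2) ops])
qed

lemma kmap_comp:
  assumes "finite A" "finite J" "finite L" "X \<in> ops A"
  shows "kmap B C L M (kmap A B J K X)
    = kmap A C (L \<times> J) (\<lambda>s c a. \<Sum>b\<in>B. M (fst s) c b * K (snd s) b a) X"
proof (rule kmap_eqI[OF linear_map_comp[OF kmap_linear kmap_linear] assms(1) _ assms(4)])
  fix a a' c c' assume *: "a \<in> A" "a' \<in> A" "c \<in> C" "c' \<in> C"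
  have "kmap B C L M (kmap A B J K (op_unit a a')) c c'
     = (\<Sum>l\<in>L. \<Sum>b\<in>B. \<Sum>b'\<in>B. \<Sum>j\<in>J. M l c b * K j b a * cnj (M l c' b' * K j b' a'))"
  proof -
    have "kmap B C L M Y c c' = (\<Sum>l\<in>L. \<Sum>b\<in>B. \<Sum>b'\<in>B. M l c b * Y b b' * cnj (M l c' b'))" for Y
      using * by (simp add: kmap_def)
    also have "(\<Sum>l\<in>L. \<Sum>b\<in>B. \<Sum>b'\<in>B. M l c b * kmap A B J K (op_unit a a') b b' * cnj (M l c' b'))
        = (\<Sum>l\<in>L. \<Sum>b\<in>B. \<Sum>b'\<in>B. \<Sum>j\<in>J. M l c b * K j b a * cnj (M l c' b' * K j b' a'))"
      using * by (intro sum.cong refl)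
        (simp add: kmap_unit[OF assms(1)] sum_distrib_left sum_distrib_right mult_ac)
    finally show ?thesis .
  qed
  also have "\<dots> = (\<Sum>l\<in>L. \<Sum>b\<in>B. \<Sum>j\<in>J. \<Sum>b'\<in>B. M l c b * K j b a * cnj (M l c' b' * K j b' a'))"
    by (intro sum.cong refl sum.swap)
  also have "\<dots> = (\<Sum>l\<in>L. \<Sum>j\<in>J. \<Sum>b\<in>B. \<Sum>b'\<in>B. M l c b * K j b a * cnj (M l c' b' * K j b' a'))"
    by (intro sum.cong refl sum.swap)
  also have "\<dots> = (\<Sum>l\<in>L. \<Sum>j\<in>J. (\<Sum>b\<in>B. M l c b * K j b a) * cnj (\<Sum>b\<in>B. M l c' b * K j b a'))"
    unfolding cnj_sum sum_product ..
  finally show "kmap B C L M (kmap A B J K (op_unit a a')) c c'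
    = (\<Sum>s\<in>L \<times> J. (\<Sum>b\<in>B. M (fst s) c b * K (snd s) b a) * cnj (\<Sum>b\<in>B. M (fst s) c' b * K (snd s) b a'))"
    by (simp only: sum.cartesian_product split_def)
qed

section \<open>Kraus operators of tensor products, for two systems and for a family of
  parties\<close>

lemma tensor_map_linear:
  assumes "linear_map A C \<Phi>" "linear_map B D \<Psi>"
  shows "linear_map (A \<times> B) (C \<times> D) (tensor_map A B \<Phi> \<Psi>)"
proof -
  have z: "\<Phi> (op_unit a a') c c' * \<Psi> (op_unit b b') d d' = 0"
    if "a \<in> A" "a' \<in> A" "b \<in> B" "b' \<in> B" "\<not> (c \<in> C \<and> d \<in> D) \<or> \<not> (c' \<in> C \<and> d' \<in> D)"
    for a a' b b' c c' d d'
    using linear_map_ops[OF assms(1) op_unit_ops[OF that(1,2)]]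
      linear_map_ops[OF assms(2) op_unit_ops[OF that(3,4)]] that(5)
    by (auto simp: ops_def)
  have "tensor_map A B \<Phi> \<Psi> X x y = 0" if "x \<notin> C \<times> D \<or> y \<notin> C \<times> D" for X x y
  proof -
    have "\<not> (fst x \<in> C \<and> snd x \<in> D) \<or> \<not> (fst y \<in> C \<and> snd y \<in> D)"
      using that by (simp add: mem_Times_iff)
    then show ?thesis
      unfolding tensor_map_def split_def mult.assoc using z
      by (intro sum.neutral ballI) simp
  qed
  then have "tensor_map A B \<Phi> \<Psi> X \<in> ops (C \<times> D)" for X
    by (simp add: ops_def)
  then show ?thesis
    unfolding linear_map_def
    by (simp add: tensor_map_def fun_eq_iff sum.distrib sum_distrib_left algebra_simps)
qed

lemma tensor_map_unit:
  assumes "finite A" "finite B" "a \<in> A" "a' \<in> A" "b \<in> B" "b' \<in> B"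
  shows "tensor_map A B \<Phi> \<Psi> (op_unit (a, b) (a', b')) x y
    = \<Phi> (op_unit a a') (fst x) (fst y) * \<Psi> (op_unit b b') (snd x) (snd y)"
proof -
  have "tensor_map A B \<Phi> \<Psi> (op_unit (a, b) (a', b')) x y
    = (\<Sum>r\<in>A. if r = a then (\<Sum>r'\<in>A. if r' = a' then (\<Sum>s\<in>B. if s = b then (\<Sum>s'\<in>B. if s' = b'
       then \<Phi> (op_unit a a') (fst x) (fst y) * \<Psi> (op_unit b b') (snd x) (snd y) else 0) else 0) else 0) else 0)"
    unfolding tensor_map_def split_def
    by (intro sum.cong refl) (auto simp: op_unit_def intro!: sum.cong)
  then show ?thesis using assms by simp
qed

lemma tensor_map_kmap:
  assumes "finite A" "finite B" "finite J" "finite L" "linear_map A C \<Phi>" "linear_map B D \<Psi>"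
    and "\<And>X. X \<in> ops A \<Longrightarrow> \<Phi> X = kmap A C J K X"
    and "\<And>X. X \<in> ops B \<Longrightarrow> \<Psi> X = kmap B D L M X"
    and "X \<in> ops (A \<times> B)"
  shows "tensor_map A B \<Phi> \<Psi> X
    = kmap (A \<times> B) (C \<times> D) (J \<times> L) (\<lambda>s x y. K (fst s) (fst x) (fst y) * M (snd s) (snd x) (snd y)) X"
proof (rule kmap_eqI[OF tensor_map_linear[OF assms(5,6)] _ _ assms(9)])
  fix p p' q q' assume *: "p \<in> A \<times> B" "p' \<in> A \<times> B" "q \<in> C \<times> D" "q' \<in> C \<times> D"
  obtain a b a' b' where p: "p = (a, b)" "p' = (a', b')" "a \<in> A" "b \<in> B" "a' \<in> A" "b' \<in> B"
    using * by blast
  have "tensor_map A B \<Phi> \<Psi> (op_unit p p') q q'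
      = (\<Sum>j\<in>J. K j (fst q) a * cnj (K j (fst q') a')) * (\<Sum>l\<in>L. M l (snd q) b * cnj (M l (snd q') b'))"
    using p * assms(1,2)
    by (auto simp: tensor_map_unit assms(7,8) op_unit_ops kmap_unit)
  also have "\<dots> = (\<Sum>s\<in>J \<times> L. K (fst s) (fst q) (fst p) * M (snd s) (snd q) (snd p) *
        cnj (K (fst s) (fst q') (fst p') * M (snd s) (snd q') (snd p')))"
    by (simp add: sum_product sum.cartesian_product split_def p mult_ac)
  finally show "tensor_map A B \<Phi> \<Psi> (op_unit p p') q q' = \<dots>" .
qed (use assms in auto)

lemma prod_double_sum_PiE:
  fixes F :: "'i \<Rightarrow> 'a \<Rightarrow> 'a \<Rightarrow> complex"
  assumes "finite I" "\<And>i. i \<in> I \<Longrightarrow> finite (A i)"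
  shows "(\<Prod>i\<in>I. \<Sum>a\<in>A i. \<Sum>a'\<in>A i. F i a a')
    = (\<Sum>p\<in>PiE I A. \<Sum>q\<in>PiE I A. \<Prod>i\<in>I. F i (p i) (q i))"
proof -
  have "(\<Prod>i\<in>I. \<Sum>a\<in>A i. \<Sum>a'\<in>A i. F i a a') = (\<Sum>p\<in>PiE I A. \<Prod>i\<in>I. \<Sum>a'\<in>A i. F i (p i) a')"
    by (rule prod_sum_PiE[OF assms])
  also have "\<dots> = (\<Sum>p\<in>PiE I A. \<Sum>q\<in>PiE I A. \<Prod>i\<in>I. F i (p i) (q i))"
    by (intro sum.cong refl prod_sum_PiE assms)
  finally show ?thesis .
qed

lemma party_tensor_linear:
  assumes "\<And>i. i \<in> I \<Longrightarrow> linear_map (A i) (B i) (T i)" "finite I"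
  shows "linear_map (PiE I A) (PiE I B) (party_tensor I A T)"
proof -
  have z: "(\<Prod>i\<in>I. T i (op_unit (p i) (q i)) (f i) (g i)) = 0"
    if pq: "p \<in> PiE I A" "q \<in> PiE I A" and fg: "f \<notin> PiE I B \<or> g \<notin> PiE I B"
      "f \<in> extensional I" "g \<in> extensional I" for p q f g
  proof -
    obtain i where i: "i \<in> I" "f i \<notin> B i \<or> g i \<notin> B i"
      using fg by (auto simp: PiE_iff)
    then have "T i (op_unit (p i) (q i)) \<in> ops (B i)"
      using pq by (intro linear_map_ops[OF assms(1)] op_unit_ops) auto
    then have "T i (op_unit (p i) (q i)) (f i) (g i) = 0"
      using i by (auto simp: ops_def)
    then show ?thesis using i assms(2) by auto
  qed
  have "party_tensor I A T X \<in> ops (PiE I B)" for X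
    using z by (auto simp: ops_def party_tensor_def intro!: sum.neutral)
  then show ?thesis
    unfolding linear_map_def
    by (auto simp: party_tensor_def fun_eq_iff sum.distrib sum_distrib_left algebra_simps)
qed

lemma party_tensor_unit:
  assumes "finite I" "\<And>i. i \<in> I \<Longrightarrow> finite (A i)" "p \<in> PiE I A" "q \<in> PiE I A"
    "f \<in> extensional I" "g \<in> extensional I"
  shows "party_tensor I A T (op_unit p q) f g = (\<Prod>i\<in>I. T i (op_unit (p i) (q i)) (f i) (g i))"
proof -
  have "party_tensor I A T (op_unit p q) f g = (\<Sum>r\<in>PiE I A. if r = p then (\<Sum>s\<in>PiE I A.
     if s = q then (\<Prod>i\<in>I. T i (op_unit (p i) (q i)) (f i) (g i)) else 0) else 0)"
    unfolding party_tensor_def using assms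
    by (auto intro!: sum.cong simp: op_unit_def)
  then show ?thesis using assms by (simp add: finite_PiE)
qed

lemma party_tensor_kmap:
  assumes I: "finite I" and A: "\<And>i. i \<in> I \<Longrightarrow> finite (A i)" and J: "\<And>i. i \<in> I \<Longrightarrow> finite (J i)"
    and T: "\<And>i. i \<in> I \<Longrightarrow> linear_map (A i) (B i) (T i)"
    and K: "\<And>i X. i \<in> I \<Longrightarrow> X \<in> ops (A i) \<Longrightarrow> T i X = kmap (A i) (B i) (J i) (K i) X"
    and X: "X \<in> ops (PiE I A)"
  shows "party_tensor I A T X
    = kmap (PiE I A) (PiE I B) (PiE I J) (\<lambda>\<sigma> f p. \<Prod>i\<in>I. K i (\<sigma> i) (f i) (p i)) X"
proof (rule kmap_eqI[OF party_tensor_linear[OF T I] finite_PiE[OF I A] _ X])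
  fix p q f g assume *: "p \<in> PiE I A" "q \<in> PiE I A" "f \<in> PiE I B" "g \<in> PiE I B"
  have "party_tensor I A T (op_unit p q) f g = (\<Prod>i\<in>I. T i (op_unit (p i) (q i)) (f i) (g i))"
    by (rule party_tensor_unit) (use * I A in \<open>auto simp: PiE_def\<close>)
  also have "\<dots> = (\<Prod>i\<in>I. \<Sum>j\<in>J i. K i j (f i) (p i) * cnj (K i j (g i) (q i)))"
  proof (intro prod.cong refl)
    fix i assume i: "i \<in> I"
    then have m: "p i \<in> A i" "q i \<in> A i" "f i \<in> B i" "g i \<in> B i" using * by auto
    show "T i (op_unit (p i) (q i)) (f i) (g i) = (\<Sum>j\<in>J i. K i j (f i) (p i) * cnj (K i j (g i) (q i)))"
      unfolding K[OF i op_unit_ops[OF m(1,2)]] by (rule kmap_unit[OF A[OF i] m])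
  qed
  also have "\<dots> = (\<Sum>\<sigma>\<in>PiE I J. \<Prod>i\<in>I. K i (\<sigma> i) (f i) (p i) * cnj (K i (\<sigma> i) (g i) (q i)))"
    by (rule prod_sum_PiE) (use I J in auto)
  finally show "party_tensor I A T (op_unit p q) f g = (\<Sum>\<sigma>\<in>PiE I J.
      (\<Prod>i\<in>I. K i (\<sigma> i) (f i) (p i)) * cnj (\<Prod>i\<in>I. K i (\<sigma> i) (g i) (q i)))"
    by (simp add: prod.distrib)
qed auto


section \<open>LOCC maps are separable\<close>

text \<open>No normalisation of the Kraus operators is demanded: the induction over protocols passes
  through single outcomes of an instrument, which need not preserve the trace.\<close>

definition separable ::
  "'i set \<Rightarrow> ('i \<Rightarrow> 'a set) \<Rightarrow> ('i \<Rightarrow> 'b set) \<Rightarrow> ('i \<Rightarrow> 'a, 'i \<Rightarrow> 'b) superoper \<Rightarrow> bool" where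
  "separable I A B \<Phi> \<longleftrightarrow> (\<exists>m K. \<forall>X\<in>ops (PiE I A).
     \<Phi> X = kmap (PiE I A) (PiE I B) {..<m::nat} (\<lambda>r f p. \<Prod>i\<in>I. K r i (f i) (p i)) X)"

text \<open>The existential in \<open>separable\<close> cannot range over types, so its labels are
  naturals. Functions, pairs and dependent pairs, which arise as labels below, are renumbered
  here.\<close>

lemma separableI:
  assumes "finite J"
    and "\<And>X. X \<in> ops (PiE I A) \<Longrightarrow>
      \<Phi> X = kmap (PiE I A) (PiE I B) J (\<lambda>r f p. \<Prod>i\<in>I. K r i (f i) (p i)) X"
  shows "separable I A B \<Phi>"
proof -
  obtain h where h: "bij_betw h {..<card J} J"
    using ex_bij_betw_nat_finite[OF assms(1)] atLeast0LessThan by metis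
  have "\<Phi> X = kmap (PiE I A) (PiE I B) {..<card J} (\<lambda>r f p. \<Prod>i\<in>I. K (h r) i (f i) (p i)) X"
    if "X \<in> ops (PiE I A)" for X
    unfolding assms(2)[OF that] kmap_def sum.reindex_bij_betw[OF h, symmetric] ..
  then show ?thesis
    unfolding separable_def by (intro exI ballI)
qed

lemma separable_cong:
  assumes "separable I A B \<Psi>" "\<And>X. X \<in> ops (PiE I A) \<Longrightarrow> \<Phi> X = \<Psi> X"
  shows "separable I A B \<Phi>"
  using assms by (simp add: separable_def)

lemma separable_party:
  assumes I: "finite I" and A: "\<And>i. i \<in> I \<Longrightarrow> finite (A i)" and B: "\<And>i. i \<in> I \<Longrightarrow> finite (B i)"
    and T: "\<And>i. i \<in> I \<Longrightarrow> linear_map (A i) (B i) (T i)"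
    and K: "\<And>i. i \<in> I \<Longrightarrow> \<exists>m K. \<forall>X\<in>ops (A i). T i X = kmap (A i) (B i) {..<m::nat} K X"
  shows "separable I A B (party_tensor I A T)"
proof -
  have "\<exists>s. \<forall>i\<in>I. \<forall>X\<in>ops (A i). T i X = kmap (A i) (B i) {..<fst (s i)::nat} (snd (s i)) X"
    by (rule bchoice) (use K in force)
  then obtain s where s: "\<And>i X. i \<in> I \<Longrightarrow> X \<in> ops (A i) \<Longrightarrow>
      T i X = kmap (A i) (B i) {..<fst (s i)::nat} (snd (s i)) X"
    by blast
  show ?thesis
  proof (rule separableI)
    show "finite (PiE I (\<lambda>i. {..<fst (s i)}))"
      using I by (intro finite_PiE) auto
  qed (rule party_tensor_kmap[OF I A _ T s], auto)
qed

text \<open>Summing a product over all intermediate strings in \<open>PiE I B\<close> factorises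
  into one sum per party, so the product of two product operators is again of product form.\<close>

lemma separable_comp:
  assumes I: "finite I" and A: "\<And>i. i \<in> I \<Longrightarrow> finite (A i)" and B: "\<And>i. i \<in> I \<Longrightarrow> finite (B i)"
    and \<Phi>: "separable I A B \<Phi>" and \<Psi>: "separable I B C \<Psi>"
  shows "separable I A C (\<lambda>X. \<Psi> (\<Phi> X))"
proof -
  obtain m K where K: "\<And>X. X \<in> ops (PiE I A) \<Longrightarrow>
     \<Phi> X = kmap (PiE I A) (PiE I B) {..<m::nat} (\<lambda>r f p. \<Prod>i\<in>I. K r i (f i) (p i)) X"
    using \<Phi> by (auto simp: separable_def)
  obtain l M where M: "\<And>X. X \<in> ops (PiE I B) \<Longrightarrow>
     \<Psi> X = kmap (PiE I B) (PiE I C) {..<l::nat} (\<lambda>r f p. \<Prod>i\<in>I. M r i (f i) (p i)) X"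
    using \<Psi> by (auto simp: separable_def)
  have fA: "finite (PiE I A)" using I A by (rule finite_PiE)
  show ?thesis
  proof (rule separableI)
    show "finite ({..<l} \<times> {..<m})" by simp
    fix X assume X: "X \<in> ops (PiE I A)"
    have "(\<Sum>p\<in>PiE I B. (\<Prod>i\<in>I. M (fst s) i (f i) (p i)) * (\<Prod>i\<in>I. K (snd s) i (p i) (q i)))
       = (\<Prod>i\<in>I. \<Sum>b\<in>B i. M (fst s) i (f i) b * K (snd s) i b (q i))" for s f q
      by (simp add: prod_sum_PiE I B prod.distrib)
    then show "\<Psi> (\<Phi> X) = kmap (PiE I A) (PiE I C) ({..<l} \<times> {..<m})
       (\<lambda>s f q. \<Prod>i\<in>I. \<Sum>b\<in>B i. M (fst s) i (f i) b * K (snd s) i b (q i)) X"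
      unfolding K[OF X] M[OF kmap_ops]
      by (subst kmap_comp[OF fA _ _ X]) simp_all
  qed
qed

lemma separable_sum:
  assumes "\<And>j. j < m \<Longrightarrow> separable I A B (\<Phi> j)"
  shows "separable I A B (\<lambda>X f g. \<Sum>j<m::nat. \<Phi> j X f g)"
proof -
  have "\<exists>s. \<forall>j\<in>{..<m}. \<forall>X\<in>ops (PiE I A).
     \<Phi> j X = kmap (PiE I A) (PiE I B) {..<fst (s j)::nat} (\<lambda>r f p. \<Prod>i\<in>I. snd (s j) r i (f i) (p i)) X"
    by (rule bchoice) (use assms in \<open>force simp: separable_def\<close>)
  then obtain s where s: "\<And>j X. j < m \<Longrightarrow> X \<in> ops (PiE I A) \<Longrightarrow>
     \<Phi> j X = kmap (PiE I A) (PiE I B) {..<fst (s j)::nat} (\<lambda>r f p. \<Prod>i\<in>I. snd (s j) r i (f i) (p i)) X"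
    by blast
  show ?thesis
  proof (rule separableI)
    show "finite (SIGMA j:{..<m}. {..<fst (s j)})" by simp
    fix X assume X: "X \<in> ops (PiE I A)"
    show "(\<lambda>f g. \<Sum>j<m. \<Phi> j X f g) = kmap (PiE I A) (PiE I B) (SIGMA j:{..<m}. {..<fst (s j)})
        (\<lambda>r f p. \<Prod>i\<in>I. snd (s (fst r)) (snd r) i (f i) (p i)) X"
    proof (intro ext)
      fix f g
      show "(\<Sum>j<m. \<Phi> j X f g) = kmap (PiE I A) (PiE I B) (SIGMA j:{..<m}. {..<fst (s j)})
        (\<lambda>r f p. \<Prod>i\<in>I. snd (s (fst r)) (snd r) i (f i) (p i)) X f g"
      proof (cases "f \<in> PiE I B \<and> g \<in> PiE I B")
        case True
        then show ?thesis
          by (simp add: s[OF _ X] kmap_def sum.Sigma split_def)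
      next
        case False
        have "\<Phi> j X f g = 0" if "j < m" for j
          unfolding s[OF that X] by (rule kmap_outside[OF False])
        then show ?thesis
          unfolding kmap_outside[OF False] by simp
      qed
    qed
  qed
qed

text \<open>Product form survives everything a protocol is built from: local maps side by side,
  continuation by a later protocol, and summation over announced outcomes. An idle party contributes
  the identity as its single Kraus operator.\<close>

lemma locc_separable:
  assumes "locc I A B \<Lambda>" "finite I" "\<And>i. i \<in> I \<Longrightarrow> finite (A i)" "\<And>i. i \<in> I \<Longrightarrow> finite (B i)"
  shows "separable I A B \<Lambda>"
  using assms
proof (induction rule: locc.induct)
  case (final A B T \<Lambda>)
  have "separable I A B (party_tensor I A T)"
  proof (rule separable_party)
    fix i assume "i \<in> I"
    then show "linear_map (A i) (B i) (T i)" "\<exists>m K. \<forall>X\<in>ops (A i). T i X = kmap (A i) (B i) {..<m::nat} K X"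
      using final by (auto simp: channel_def cp_map_def intro!: cp_kraus)
  qed (use final in auto)
  then show ?case by (rule separable_cong) (use final in auto)
next
  case (round k A' A m F B \<Lambda>' \<Lambda>)
  let ?A = "A(k := A')" and ?F = "\<lambda>j. (\<lambda>i Y. Y)(k := F j)"
  have fin: "finite (?A i)" if "i \<in> I" for i using round that by simp
  have "separable I A B (\<lambda>X f g. \<Sum>j<m. \<Lambda>' j (party_tensor I A (?F j) X) f g)"
  proof (rule separable_sum)
    fix j assume j: "j < m"
    have cp: "cp_map (A k) A' (F j)" using round j by (simp add: instrument_def)
    have "separable I A ?A (party_tensor I A (?F j))"
    proof (rule separable_party)
      fix i assume i: "i \<in> I"
      have id: "linear_map S S (\<lambda>Y. Y)" for S :: "'b set" by (simp add: linear_map_def)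
      show "linear_map (A i) (?A i) (?F j i)"
        using cp id by (auto simp: cp_map_def)
      have "X = kmap (A i) (A i) {..<1::nat} (\<lambda>_ b a. of_bool (b = a)) X" if "X \<in> ops (A i)" for X
        by (rule kmap_eqI[OF id _ _ that]) (use round i in \<open>auto simp: op_unit_def\<close>)
      then show "\<exists>m K. \<forall>X\<in>ops (A i). ?F j i X = kmap (A i) (?A i) {..<m::nat} K X"
        using cp_kraus[OF cp] round i by auto
    qed (use round fin in auto)
    moreover have "separable I ?A B (\<Lambda>' j)"
      by (rule round.IH[OF j round.prems(1) fin round.prems(3)])
    ultimately show "separable I A B (\<lambda>X. \<Lambda>' j (party_tensor I A (?F j) X))"
      using separable_comp[of I A ?A "party_tensor I A (?F j)" B "\<Lambda>' j"] round.prems fin by blast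
  qed
  then show ?case by (rule separable_cong) (use round in auto)
qed


section \<open>Side-channels of a working scheme\<close>

lemma op_trace_mult_unit:
  assumes "finite A" "a \<in> A" "a' \<in> A"
  shows "op_trace A (op_mult A M (op_unit a a')) = M a' a"
proof -
  have "(\<Sum>i\<in>A. \<Sum>k\<in>A. M i k * op_unit a a' k i)
      = (\<Sum>i\<in>A. if i = a' then \<Sum>k\<in>A. if k = a then M i k else 0 else 0)"
    by (intro sum.cong refl) (auto simp: op_unit_def intro!: sum.cong)
  then show ?thesis
    using assms by (simp add: op_trace_def op_mult_def)
qed

text \<open>Splitting each effect \<open>M j\<close> and each state \<open>\<rho> j\<close> into
  rank-one terms turns measure-and-prepare into Kraus operators of the form ket times bra. The kets
  \<open>\<phi>\<close> come from the prepared states, the bras \<open>\<psi>\<close> from the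
  effects; a label consists of the outcome and one term of each splitting.\<close>

lemma entanglement_breaking_kraus:
  assumes "entanglement_breaking A B \<Phi>" "finite A" "finite B"
  shows "\<exists>J :: (nat \<times> nat \<times> nat) set. \<exists>\<phi> \<psi>. finite J \<and>
    (\<forall>X\<in>ops A. \<Phi> X = kmap A B J (\<lambda>j b a. \<phi> j b * cnj (\<psi> j a)) X)"
proof -
  obtain m M \<rho> where M: "povm A m M" and \<rho>: "\<forall>j<m. density B (\<rho> j)"
    and \<Phi>: "\<forall>X\<in>ops A. \<Phi> X = (\<lambda>a b. \<Sum>j<m. op_trace A (op_mult A (M j) X) * \<rho> j a b)"
    and ch: "channel A B \<Phi>"
    using assms(1) by (auto simp: entanglement_breaking_def)
  have lin: "linear_map A B \<Phi>" using ch by (simp add: channel_def cp_map_def)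
  have "\<exists>s. \<forall>j\<in>{..<m}. \<forall>a\<in>A. \<forall>a'\<in>A.
      M j a a' = (\<Sum>r<fst (s j) :: nat. snd (s j) r a * cnj (snd (s j) r a'))"
    by (rule bchoice) (use psd_rank_one_sum[OF assms(2)] M in \<open>force simp: povm_def\<close>)
  then obtain u where u: "\<And>j a a'. \<lbrakk>j < m; a \<in> A; a' \<in> A\<rbrakk> \<Longrightarrow>
      M j a a' = (\<Sum>r<fst (u j) :: nat. snd (u j) r a * cnj (snd (u j) r a'))"
    by blast
  have "\<exists>s. \<forall>j\<in>{..<m}. \<forall>a\<in>B. \<forall>a'\<in>B.
      \<rho> j a a' = (\<Sum>r<fst (s j) :: nat. snd (s j) r a * cnj (snd (s j) r a'))"
    by (rule bchoice) (use psd_rank_one_sum[OF assms(3)] \<rho> in \<open>force simp: density_def\<close>)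
  then obtain v where v: "\<And>j a a'. \<lbrakk>j < m; a \<in> B; a' \<in> B\<rbrakk> \<Longrightarrow>
      \<rho> j a a' = (\<Sum>r<fst (v j) :: nat. snd (v j) r a * cnj (snd (v j) r a'))"
    by blast
  define J where "J = (SIGMA j:{..<m}. {..<fst (u j)} \<times> {..<fst (v j)})"
  define \<phi> where "\<phi> = (\<lambda>s :: nat \<times> nat \<times> nat. snd (v (fst s)) (snd (snd s)))"
  define \<psi> where "\<psi> = (\<lambda>s :: nat \<times> nat \<times> nat. snd (u (fst s)) (fst (snd s)))"
  have J: "(\<Sum>j\<in>J. f j) = (\<Sum>j<m. \<Sum>x\<in>{..<fst (u j)} \<times> {..<fst (v j)}. f (j, x))"
    for f :: "_ \<Rightarrow> complex"
    by (simp add: J_def sum.Sigma split_def)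
  have "\<Phi> X = kmap A B J (\<lambda>j b a. \<phi> j b * cnj (\<psi> j a)) X" if "X \<in> ops A" for X
  proof (rule kmap_eqI[OF lin assms(2) _ that])
    fix a a' b b' assume *: "a \<in> A" "a' \<in> A" "b \<in> B" "b' \<in> B"
    have "\<Phi> (op_unit a a') b b' = (\<Sum>j<m. M j a' a * \<rho> j b b')"
      using \<Phi> * op_unit_ops[of a A a'] by (simp add: op_trace_mult_unit[OF assms(2)])
    also have "\<dots> = (\<Sum>j<m. (\<Sum>r<fst (u j). snd (u j) r a' * cnj (snd (u j) r a)) *
        (\<Sum>s<fst (v j). snd (v j) s b * cnj (snd (v j) s b')))"
      using * by (intro sum.cong refl) (simp add: u v)
    also have "\<dots> = (\<Sum>j\<in>J. \<phi> j b * cnj (\<psi> j a) * cnj (\<phi> j b' * cnj (\<psi> j a')))"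
      by (simp add: J \<phi>_def \<psi>_def sum_product sum.cartesian_product split_def mult_ac)
    finally show "\<Phi> (op_unit a a') b b' = \<dots>" .
  qed
  moreover have "finite J" by (simp add: J_def)
  ultimately show ?thesis by blast
qed

lemma sum_mult_cnj_eq_0D:
  assumes "finite J" "(\<Sum>j\<in>J. z j * cnj (z j)) = 0" "j \<in> J"
  shows "z j = 0"
proof -
  have "(\<Sum>j\<in>J. z j * cnj (z j)) = of_real (\<Sum>j\<in>J. (cmod (z j))\<^sup>2)"
    unfolding of_real_sum complex_norm_square ..
  then have "(\<Sum>j\<in>J. (cmod (z j))\<^sup>2) = 0"
    using assms(2) by (metis of_real_eq_0_iff)
  then show ?thesis
    using assms by (simp add: sum_nonneg_eq_0_iff)
qed

text \<open>Off the diagonal, the sum over j of |W j b a|^2 is 0. On it, the sum of |W j a a - W j c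
  c|^2 expands to 1 - 1 - 1 + 1 = 0. In both cases every summand vanishes.\<close>

lemma identity_kraus:
  assumes "finite J"
    and W: "\<And>a a' b b'. \<lbrakk>a \<in> A; a' \<in> A; b \<in> A; b' \<in> A\<rbrakk> \<Longrightarrow>
      (\<Sum>j\<in>J. W j b a * cnj (W j b' a')) = of_bool (b = a \<and> b' = a')"
    and j: "j \<in> J" "a \<in> A" "b \<in> A" "c \<in> A"
  shows "W j b a = of_bool (b = a) * W j c c"
proof (cases "b = a")
  case False
  have "(\<Sum>j\<in>J. W j b a * cnj (W j b a)) = 0"
    using W[of a a b b] j False by simp
  then show ?thesis
    using sum_mult_cnj_eq_0D[OF assms(1) _ j(1), of "\<lambda>j. W j b a"] False by simp
next
  case True
  have "(\<Sum>j\<in>J. (W j a a - W j c c) * cnj (W j a a - W j c c)) = 0"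
    using W[of a a a a] W[of a c a c] W[of c a c a] W[of c c c c] j
    by (simp add: algebra_simps sum.distrib sum_subtractf)
  then have "W j a a - W j c c = 0"
    using sum_mult_cnj_eq_0D[OF assms(1) _ j(1), of "\<lambda>j. W j a a - W j c c"] by simp
  then show ?thesis using True by simp
qed

section \<open>Square matrices: one-sided inverses and proportional middle factors\<close>

lemma square_inverse_commute:
  fixes L M :: "nat \<Rightarrow> nat \<Rightarrow> complex"
  assumes "\<And>a b. a < d \<Longrightarrow> b < d \<Longrightarrow> (\<Sum>k<d. L a k * M k b) = of_bool (a = b)"
    and "a < d" "b < d"
  shows "(\<Sum>k<d. M a k * L k b) = of_bool (a = b)"
proof -
  let ?m = "\<lambda>X :: nat \<Rightarrow> nat \<Rightarrow> complex. mat d d (\<lambda>(i, j). X i j)"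
  have "?m L * ?m M = 1\<^sub>m d"
    using assms(1) by (intro eq_matI) (simp_all add: scalar_prod_def atLeast0LessThan)
  then have "?m M * ?m L = 1\<^sub>m d"
    by (rule mat_mult_left_right_inverse[rotated 2]) auto
  then have "(?m M * ?m L) $$ (a, b) = 1\<^sub>m d $$ (a, b)" by simp
  then show ?thesis
    using assms(2,3) by (simp add: scalar_prod_def atLeast0LessThan)
qed

lemma mat_scalar_inverse_commute:
  fixes A B :: "complex mat"
  assumes A: "A \<in> carrier_mat d d" and B: "B \<in> carrier_mat d d"
    and AB: "A * B = l \<cdot>\<^sub>m 1\<^sub>m d" and "l \<noteq> 0"
  shows "B * A = l \<cdot>\<^sub>m 1\<^sub>m d"
proof -
  let ?B = "inverse l \<cdot>\<^sub>m B"
  have B': "?B \<in> carrier_mat d d" using B by simp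
  have "A * ?B = inverse l \<cdot>\<^sub>m (A * B)"
    using A B by (simp add: mult_smult_distrib)
  also have "\<dots> = 1\<^sub>m d"
    unfolding AB using \<open>l \<noteq> 0\<close> by (intro eq_matI) auto
  finally have "?B * A = 1\<^sub>m d"
    by (rule mat_mult_left_right_inverse[OF A B'])
  then have "l \<cdot>\<^sub>m (?B * A) = l \<cdot>\<^sub>m 1\<^sub>m d" by simp
  moreover have "l \<cdot>\<^sub>m (?B * A) = B * A"
    using A B \<open>l \<noteq> 0\<close> by (intro eq_matI) (auto simp: mult_smult_assoc_mat)
  ultimately show ?thesis by simp
qed

text \<open>For square matrices the scalar L S M = l may be rotated cyclically, giving S M L = l and
  M L S = l. Evaluating (S M L) S' (M L S) directly gives l^2 S', while regrouping around L S' M = k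
  gives k l S. Thus no inverse of L or M has to be written down.\<close>

lemma mat_sandwich_proportional:
  fixes L M S S' :: "complex mat"
  assumes c: "L \<in> carrier_mat d d" "M \<in> carrier_mat d d" "S \<in> carrier_mat d d" "S' \<in> carrier_mat d d"
    and S: "L * S * M = l \<cdot>\<^sub>m 1\<^sub>m d" and S': "L * S' * M = k \<cdot>\<^sub>m 1\<^sub>m d" and "l \<noteq> 0"
  shows "S' = (k / l) \<cdot>\<^sub>m S"
proof -
  have "L * (S * M) = l \<cdot>\<^sub>m 1\<^sub>m d"
    using S c by (simp add: assoc_mult_mat[of _ d d _ d _ d])
  then have inv_L: "S * M * L = l \<cdot>\<^sub>m 1\<^sub>m d"
    using mat_scalar_inverse_commute[of L d "S * M"] c \<open>l \<noteq> 0\<close> by simp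
  have inv_M: "M * (L * S) = l \<cdot>\<^sub>m 1\<^sub>m d"
    using mat_scalar_inverse_commute[of "L * S" d M] c S \<open>l \<noteq> 0\<close> by simp
  have "(S * M * L) * S' * (M * (L * S)) = S * M * (L * S' * M) * (L * S)"
    using c by (simp add: assoc_mult_mat[of _ d d _ d _ d])
  also have "\<dots> = S * M * (k \<cdot>\<^sub>m (L * S))"
    unfolding S' using c
    by (simp add: assoc_mult_mat[of _ d d _ d _ d] mult_smult_assoc_mat[of _ d d _ d])
  also have "\<dots> = k \<cdot>\<^sub>m (S * (M * (L * S)))"
    using c by (simp add: assoc_mult_mat[of _ d d _ d _ d] mult_smult_distrib[of _ d d _ d])
  finally have "(l \<cdot>\<^sub>m 1\<^sub>m d) * S' * (l \<cdot>\<^sub>m 1\<^sub>m d) = k \<cdot>\<^sub>m (S * (l \<cdot>\<^sub>m 1\<^sub>m d))"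
    unfolding inv_L inv_M .
  then have "l \<cdot>\<^sub>m (l \<cdot>\<^sub>m S') = k \<cdot>\<^sub>m (l \<cdot>\<^sub>m S)"
    using c by (simp add: mult_smult_distrib[of _ d d _ d] mult_smult_assoc_mat[of _ d d _ d])
  then have e: "(l \<cdot>\<^sub>m (l \<cdot>\<^sub>m S')) $$ (i, j) = (k \<cdot>\<^sub>m (l \<cdot>\<^sub>m S)) $$ (i, j)" for i j by simp
  show ?thesis
  proof (rule eq_matI)
    fix i j assume "i < dim_row ((k / l) \<cdot>\<^sub>m S)" "j < dim_col ((k / l) \<cdot>\<^sub>m S)"
    then show "S' $$ (i, j) = ((k / l) \<cdot>\<^sub>m S) $$ (i, j)"
      using e[of i j] c \<open>l \<noteq> 0\<close> by (auto simp: field_simps)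
  qed (use c in auto)
qed

lemma sandwich_proportional:
  fixes L M S S' :: "nat \<Rightarrow> nat \<Rightarrow> complex"
  assumes S: "\<And>c a. \<lbrakk>c < d; a < d\<rbrakk> \<Longrightarrow> (\<Sum>s<d. \<Sum>b<d. L c s * S s b * M b a) = of_bool (c = a) * l"
    and S': "\<And>c a. \<lbrakk>c < d; a < d\<rbrakk> \<Longrightarrow> (\<Sum>s<d. \<Sum>b<d. L c s * S' s b * M b a) = of_bool (c = a) * k"
    and "l \<noteq> 0" "a < d" "b < d"
  shows "S' a b = (k / l) * S a b"
proof -
  let ?m = "\<lambda>X :: nat \<Rightarrow> nat \<Rightarrow> complex. mat d d (\<lambda>(i, j). X i j)"
  have "?m L * ?m X * ?m M = z \<cdot>\<^sub>m 1\<^sub>m d"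
    if X: "\<And>c a. \<lbrakk>c < d; a < d\<rbrakk> \<Longrightarrow> (\<Sum>s<d. \<Sum>b<d. L c s * X s b * M b a) = of_bool (c = a) * z" for X z
  proof (rule eq_matI)
    fix c a assume "c < dim_row (z \<cdot>\<^sub>m 1\<^sub>m d :: complex mat)" "a < dim_col (z \<cdot>\<^sub>m 1\<^sub>m d :: complex mat)"
    then have "c < d" "a < d" by auto
    then have "(?m L * ?m X * ?m M) $$ (c, a) = (\<Sum>b<d. (\<Sum>s<d. L c s * X s b) * M b a)"
      by (simp add: scalar_prod_def atLeast0LessThan)
    also have "\<dots> = (\<Sum>s<d. \<Sum>b<d. L c s * X s b * M b a)"
      unfolding sum_distrib_right by (rule sum.swap)
    finally show "(?m L * ?m X * ?m M) $$ (c, a) = (z \<cdot>\<^sub>m 1\<^sub>m d) $$ (c, a)"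
      using X \<open>c < d\<close> \<open>a < d\<close> by simp
  qed auto
  from mat_sandwich_proportional[OF _ _ _ _ this[OF S] this[OF S'] \<open>l \<noteq> 0\<close>]
  have "?m S' = (k / l) \<cdot>\<^sub>m ?m S" by simp
  then have "?m S' $$ (a, b) = ((k / l) \<cdot>\<^sub>m ?m S) $$ (a, b)" by simp
  then show ?thesis using assms(4,5) by simp
qed

text \<open>Proportional Kraus operators merge into a single one, \<open>K\<^sub>0\<close> scaled by
  the root of the sum \<open>\<alpha>\<close> of all |c t|^2. Trace preservation makes it an
  isometry, and being square it is unitary.\<close>

lemma noiseless_of_proportional_kraus:
  fixes d :: nat
  assumes ch: "channel {..<d} {..<d} \<S>" and "finite T"
    and K: "\<And>X. X \<in> ops {..<d} \<Longrightarrow> \<S> X = kmap {..<d} {..<d} T K X"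
    and proportional: "\<And>t s b. \<lbrakk>t \<in> T; s < d; b < d\<rbrakk> \<Longrightarrow> K t s b = c t * K\<^sub>0 s b"
  shows "noiseless {..<d} \<S>"
proof -
  define \<alpha> where "\<alpha> = (\<Sum>t\<in>T. (cmod (c t))\<^sup>2)"
  have "\<alpha> \<ge> 0" by (simp add: \<alpha>_def sum_nonneg)
  then have \<alpha>: "complex_of_real (sqrt \<alpha>) * complex_of_real (sqrt \<alpha>) = of_real \<alpha>"
    by (metis of_real_mult real_sqrt_mult_self abs_of_nonneg)
  define U where "U = (\<lambda>s b. if s < d \<and> b < d then of_real (sqrt \<alpha>) * K\<^sub>0 s b else 0)"
  have U: "(\<Sum>t\<in>T. K t s b * cnj (K t s' b')) = U s b * cnj (U s' b')"
    if "s < d" "b < d" "s' < d" "b' < d" for s b s' b'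
  proof -
    have "(\<Sum>t\<in>T. K t s b * cnj (K t s' b')) = (\<Sum>t\<in>T. of_real ((cmod (c t))\<^sup>2)) * (K\<^sub>0 s b * cnj (K\<^sub>0 s' b'))"
      unfolding sum_distrib_right
      by (intro sum.cong refl) (use that in \<open>simp add: proportional complex_norm_square mult_ac del: of_real_power\<close>)
    also have "\<dots> = (complex_of_real (sqrt \<alpha>) * complex_of_real (sqrt \<alpha>)) * (K\<^sub>0 s b * cnj (K\<^sub>0 s' b'))"
      unfolding \<alpha> by (simp add: \<alpha>_def)
    also have "\<dots> = U s b * cnj (U s' b')"
      using that by (simp add: U_def mult_ac)
    finally show ?thesis .
  qed
  have iso: "(\<Sum>s<d. cnj (U s b) * U s b') = of_bool (b = b')" if "b < d" "b' < d" for b b'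
  proof -
    \<comment> \<open>Trace preservation tested on this matrix unit is the (b, b') entry of the
      isometry condition; hence the swapped order of the labels.\<close>
    have "op_trace {..<d} (\<S> (op_unit b' b)) = op_trace {..<d} (op_unit b' b)"
      using ch that by (simp add: channel_def op_unit_ops)
    also have "op_trace {..<d} (op_unit b' b) = of_bool (b = b')"
    proof -
      have "op_trace {..<d} (op_unit b' b) = (\<Sum>i<d. if i = b then of_bool (b = b') else 0)"
        unfolding op_trace_def op_unit_def by (intro sum.cong) auto
      then show ?thesis using that by simp
    qed
    also have "op_trace {..<d} (\<S> (op_unit b' b)) = (\<Sum>s<d. cnj (U s b) * U s b')"
      using that by (simp add: op_trace_def K op_unit_ops kmap_unit U mult.commute)
    finally show ?thesis .
  qed
  \<comment> \<open>Equal input and output dimension: the left inverse is also a right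
    inverse.\<close>
  have coiso: "(\<Sum>s<d. U b s * cnj (U b' s)) = of_bool (b = b')" if "b < d" "b' < d" for b b'
    using square_inverse_commute[of d "\<lambda>b s. cnj (U s b)" U] iso that by simp
  have U0: "U s b = 0" if "\<not> (s < d \<and> b < d)" for s b
    using that by (auto simp: U_def)
  have "op_mult {..<d} (op_adj U) U b b' = op_id {..<d} b b'" for b b'
    using iso[of b b'] U0 by (cases "b < d \<and> b' < d") (auto simp: op_mult_def op_adj_def op_id_def)
  moreover have "op_mult {..<d} U (op_adj U) b b' = op_id {..<d} b b'" for b b'
    using coiso[of b b'] U0 by (cases "b < d \<and> b' < d") (auto simp: op_mult_def op_adj_def op_id_def)
  ultimately have "unitary {..<d} U"
    using U0 by (auto simp: unitary_def ops_def fun_eq_iff)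
  moreover have "\<S> X = op_mult {..<d} (op_mult {..<d} U X) (op_adj U)" if X: "X \<in> ops {..<d}" for X
  proof -
    have "\<S> X = kmap {..<d} {..<d} {()} (\<lambda>_. U) X"
      by (rule kmap_eqI[OF _ _ _ X])
        (use ch in \<open>auto simp: channel_def cp_map_def K op_unit_ops kmap_unit U\<close>)
    also have "\<dots> = op_mult {..<d} (op_mult {..<d} U X) (op_adj U)"
    proof (intro ext)
      fix i j
      have "op_mult {..<d} (op_mult {..<d} U X) (op_adj U) i j
          = (\<Sum>a<d. \<Sum>a'<d. U i a * X a a' * cnj (U j a'))"
        unfolding op_mult_def op_adj_def sum_distrib_right by (rule sum.swap)
      then show "kmap {..<d} {..<d} {()} (\<lambda>_. U) X i j
          = op_mult {..<d} (op_mult {..<d} U X) (op_adj U) i j"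
        by (auto simp: kmap_def U_def)
    qed
    finally show ?thesis .
  qed
  ultimately show ?thesis by (auto simp: noiseless_def)
qed

section \<open>Factorisation of a single branch of the scheme through the side-channel of one
  receiver\<close>

lemma sum_group_fibres:
  fixes F :: "'a \<Rightarrow> complex"
  assumes "finite B" "\<And>p. p \<in> P \<Longrightarrow> g p \<in> B"
  shows "(\<Sum>p\<in>P. F (g p) * G p) = (\<Sum>b\<in>B. F b * (\<Sum>p\<in>P. of_bool (g p = b) * G p))"
proof -
  have "(\<Sum>b\<in>B. F b * (\<Sum>p\<in>P. of_bool (g p = b) * G p)) = (\<Sum>b\<in>B. \<Sum>p\<in>P. if g p = b then F b * G p else 0)"
    by (intro sum.cong refl) (auto simp: sum_distrib_left intro!: sum.cong)
  also have "\<dots> = (\<Sum>p\<in>P. \<Sum>b\<in>B. if g p = b then F b * G p else 0)"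
    by (rule sum.swap)
  also have "\<dots> = (\<Sum>p\<in>P. F (g p) * G p)"
    by (intro sum.cong refl) (use assms in \<open>simp add: sum.delta\<close>)
  finally show ?thesis ..
qed

text \<open>
  The Kraus operator of the whole scheme (input entry \<open>a\<close>, output entry \<open>c\<close> at receiver \<open>x\<close>) for
  fixed branches of encoder, channels and protocol, as a function of the branch \<open>S\<close> of the
  side-channel of \<open>x\<close>. The other receivers output the basis vector 0.
\<close>

definition branch_op ::
  "'i set \<Rightarrow> ('i \<Rightarrow> (nat \<times> nat) set) \<Rightarrow> ('i \<Rightarrow> (nat \<times> nat) set) \<Rightarrow> 'i \<Rightarrow>
    ('i \<Rightarrow> nat \<Rightarrow> nat \<times> nat \<Rightarrow> complex) \<Rightarrow> (nat \<Rightarrow> complex) \<Rightarrow> (nat \<Rightarrow> complex) \<Rightarrow>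
    ('i \<Rightarrow> nat \<times> nat \<Rightarrow> nat \<times> nat \<Rightarrow> complex) \<Rightarrow> (('i \<Rightarrow> nat \<times> nat) \<Rightarrow> nat \<Rightarrow> complex) \<Rightarrow>
    (nat \<Rightarrow> nat \<Rightarrow> complex) \<Rightarrow> nat \<Rightarrow> nat \<Rightarrow> complex" where
  "branch_op I P Q x V \<phi> \<psi> N E S c a =
     (\<Sum>f\<in>PiE I Q. (\<Prod>i\<in>I. V i (if i = x then c else 0) (f i)) *
        (\<Sum>p\<in>PiE I P. (\<Prod>i\<in>I. if i = x then \<phi> (fst (f x)) * cnj (\<psi> (fst (p x))) * S (snd (f x)) (snd (p x))
            else N i (f i) (p i)) * E p a))"

text \<open>The order of quantifiers is the point: \<open>L\<close> and \<open>M\<close> are fixed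
  before \<open>S\<close>. The sum over output strings factorises by party. At \<open>x\<close> the
  rank-one Kraus operator separates: its ket is contracted with the decoder into \<open>L\<close>,
  its bra goes with the other parties and the encoder into \<open>M\<close>.\<close>

lemma branch_op_sandwich:
  assumes "finite I" "x \<in> I"
    and "\<And>i. i \<in> I \<Longrightarrow> finite (P i)" "\<And>i. i \<in> I \<Longrightarrow> finite (Q i)"
    and "Q x = R \<times> {..<d}" "P x = H \<times> {..<d}"
  shows "\<exists>L M. \<forall>S c a. branch_op I P Q x V \<phi> \<psi> N E S c a = (\<Sum>s<d. \<Sum>b<d. L c s * S s b * M b a)"
proof -
  \<comment> \<open>The number contributed by a party \<open>i\<close> other than \<open>x\<close>
    on the basis input \<open>q\<close>; the 0 is its only output label.\<close>
  define G where "G = (\<lambda>i q. \<Sum>f\<in>Q i. V i 0 f * N i f q)"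
  define L where "L = (\<lambda>c s. \<Sum>r\<in>R. V x c (r, s) * \<phi> r)"
  define K where "K = (\<lambda>p a. cnj (\<psi> (fst (p x))) * (\<Prod>i\<in>I - {x}. G i (p i)) * E p a)"
  define M where "M = (\<lambda>b a. \<Sum>p\<in>PiE I P. of_bool (snd (p x) = b) * K p a)"
  have fin: "finite (PiE I P)" "finite (PiE I Q)"
    using assms by (auto intro: finite_PiE)
  have "branch_op I P Q x V \<phi> \<psi> N E S c a = (\<Sum>s<d. \<Sum>b<d. L c s * S s b * M b a)" for S c a
  proof -
    let ?V = "\<lambda>i. V i (if i = x then c else 0)"
    let ?N = "\<lambda>i u q. if i = x then \<phi> (fst u) * cnj (\<psi> (fst q)) * S (snd u) (snd q) else N i u q"
    have N: "(\<Prod>i\<in>I. if i = x then \<phi> (fst (f x)) * cnj (\<psi> (fst (p x))) * S (snd (f x)) (snd (p x))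
        else N i (f i) (p i)) = (\<Prod>i\<in>I. ?N i (f i) (p i))" for f p
      by (intro prod.cong) auto
    have "branch_op I P Q x V \<phi> \<psi> N E S c a
      = (\<Sum>f\<in>PiE I Q. \<Sum>p\<in>PiE I P. (\<Prod>i\<in>I. ?V i (f i) * ?N i (f i) (p i)) * E p a)"
      unfolding branch_op_def N by (simp only: sum_distrib_left prod.distrib mult.assoc)
    also have "\<dots> = (\<Sum>p\<in>PiE I P. \<Sum>f\<in>PiE I Q. (\<Prod>i\<in>I. ?V i (f i) * ?N i (f i) (p i)) * E p a)"
      by (rule sum.swap)
    also have "\<dots> = (\<Sum>p\<in>PiE I P. (\<Prod>i\<in>I. \<Sum>u\<in>Q i. ?V i u * ?N i u (p i)) * E p a)"
      unfolding sum_distrib_right[symmetric]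
      by (intro sum.cong refl arg_cong2[where f = "(*)"] prod_sum_PiE[symmetric] assms)
    also have "\<dots> = (\<Sum>p\<in>PiE I P. (\<Sum>s<d. L c s * S s (snd (p x))) * K p a)"
    proof (intro sum.cong refl)
      fix p
      have "(\<Prod>i\<in>I. \<Sum>u\<in>Q i. ?V i u * ?N i u (p i))
          = (\<Sum>u\<in>Q x. ?V x u * ?N x u (p x)) * (\<Prod>i\<in>I - {x}. \<Sum>u\<in>Q i. ?V i u * ?N i u (p i))"
        using assms(1,2) by (rule prod.remove)
      also have "(\<Prod>i\<in>I - {x}. \<Sum>u\<in>Q i. ?V i u * ?N i u (p i)) = (\<Prod>i\<in>I - {x}. G i (p i))"
        by (intro prod.cong refl) (auto simp: G_def)
      also have "(\<Sum>u\<in>Q x. ?V x u * ?N x u (p x))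
          = (\<Sum>r\<in>R. \<Sum>s<d. V x c (r, s) * \<phi> r * S s (snd (p x)) * cnj (\<psi> (fst (p x))))"
        unfolding assms(5) by (simp add: sum.cartesian_product split_def mult_ac)
      also have "\<dots> = (\<Sum>s<d. L c s * S s (snd (p x))) * cnj (\<psi> (fst (p x)))"
        unfolding L_def sum_distrib_right by (rule sum.swap)
      finally show "(\<Prod>i\<in>I. \<Sum>u\<in>Q i. ?V i u * ?N i u (p i)) * E p a
          = (\<Sum>s<d. L c s * S s (snd (p x))) * K p a"
        by (simp add: K_def mult_ac)
    qed
    \<comment> \<open>The factor in front of \<open>K p a\<close> sees \<open>p\<close> only through
      the side-channel input \<open>snd (p x)\<close>. Collecting the strings by this label
      \<open>b\<close> produces the \<open>d\<close> rows of \<open>M\<close>.\<close>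
    also have "\<dots> = (\<Sum>b<d. (\<Sum>s<d. L c s * S s b) * M b a)"
      unfolding M_def
      by (rule sum_group_fibres[where F = "\<lambda>b. \<Sum>s<d. L c s * S s b"])
        (use PiE_mem[OF _ assms(2), of _ P] assms(6) in \<open>auto simp: mem_Times_iff\<close>)
    also have "\<dots> = (\<Sum>s<d. \<Sum>b<d. L c s * S s b * M b a)"
      unfolding sum_distrib_right by (rule sum.swap)
    finally show ?thesis .
  qed
  then show ?thesis
    by (intro exI[of _ L] exI[of _ M] allI)
qed

lemma rrqc_possible_imp_noiseless:
  fixes d n x :: nat and h k :: "nat \<Rightarrow> nat" and C S :: "nat \<Rightarrow> (nat, nat) superoper"
  assumes "1 \<le> d"
    and C: "\<And>i. i \<in> {1..n} \<Longrightarrow> entanglement_breaking {..<h i} {..<k i} (C i)"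
    and S: "\<And>i. i \<in> {1..n} \<Longrightarrow> channel {..<d} {..<d} (S i)"
    and possible: "rrqc_possible d n (\<lambda>i. {..<h i} \<times> {..<d}) (\<lambda>i. {..<k i} \<times> {..<d})
           (\<lambda>i. tensor_map {..<h i} {..<d} (C i) (S i))"
    and x: "x \<in> {1..n}"
  shows "noiseless {..<d} (S x)"
proof -
  define I where "I = {1..n}"
  define P where "P = (\<lambda>i. {..<h i} \<times> {..<d})"
  define Q where "Q = (\<lambda>i. {..<k i} \<times> {..<d})"
  define B where "B = output_sys d x"
  define N where "N = (\<lambda>i. tensor_map {..<h i} {..<d} (C i) (S i))"
  note [simp] = x[folded I_def]
  have I: "finite I" by (simp add: I_def)
  have fin: "finite (P i)" "finite (Q i)" "finite (B i)" for i
    by (simp_all add: P_def Q_def B_def output_sys_def)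
  have finP: "finite (PiE I P)" using I fin by (intro finite_PiE) auto
  obtain E \<Lambda> where E: "channel {..<d} (PiE I P) E" and locc: "locc I Q B \<Lambda>"
    and \<Lambda>: "\<And>\<rho>. \<rho> \<in> ops {..<d} \<Longrightarrow> \<Lambda> (party_tensor I P N (E \<rho>)) = at_receiver n d x \<rho>"
    using possible x unfolding rrqc_possible_def I_def P_def Q_def B_def N_def by blast
  have linC: "linear_map {..<h i} {..<k i} (C i)" if "i \<in> I" for i
    using C[of i] that by (simp add: I_def entanglement_breaking_def channel_def cp_map_def)
  have linS: "linear_map {..<d} {..<d} (S i)" if "i \<in> I" for i
    using S[of i] that by (simp add: I_def channel_def cp_map_def)

  obtain mE KE where KE: "\<And>X. X \<in> ops {..<d} \<Longrightarrow> E X = kmap {..<d} (PiE I P) {..<mE::nat} KE X"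
    using cp_kraus[of "{..<d}" "PiE I P" E] E finP by (auto simp: channel_def)
  have "\<exists>s. \<forall>i\<in>I. finite (fst (s i) :: (nat \<times> nat \<times> nat) set) \<and> (\<forall>X\<in>ops {..<h i}. C i X
      = kmap {..<h i} {..<k i} (fst (s i)) (\<lambda>j b a. fst (snd (s i)) j b * cnj (snd (snd (s i)) j a)) X)"
    by (rule bchoice) (use entanglement_breaking_kraus[OF C] in \<open>force simp: I_def\<close>)
  then obtain s where s: "\<And>i. i \<in> I \<Longrightarrow> finite (fst (s i) :: (nat \<times> nat \<times> nat) set)"
    "\<And>i X. i \<in> I \<Longrightarrow> X \<in> ops {..<h i} \<Longrightarrow> C i X
      = kmap {..<h i} {..<k i} (fst (s i)) (\<lambda>j b a. fst (snd (s i)) j b * cnj (snd (snd (s i)) j a)) X"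
    by blast
  define JC \<phi> \<psi> where "JC i = fst (s i)" and "\<phi> i = fst (snd (s i))"
    and "\<psi> i = snd (snd (s i))" for i
  note KC = s[folded JC_def \<phi>_def \<psi>_def]
  have "\<exists>s. \<forall>i\<in>I. \<forall>X\<in>ops {..<d}. S i X = kmap {..<d} {..<d} {..<fst (s i) :: nat} (snd (s i)) X"
    by (rule bchoice) (use cp_kraus[of "{..<d}" "{..<d}"] S in \<open>force simp: I_def channel_def\<close>)
  then obtain t where t: "\<And>i X. i \<in> I \<Longrightarrow> X \<in> ops {..<d} \<Longrightarrow>
      S i X = kmap {..<d} {..<d} {..<fst (t i) :: nat} (snd (t i)) X"
    by blast
  define mS KS where "mS i = fst (t i)" and "KS i = snd (t i)" for i
  note KS = t[folded mS_def KS_def]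
  define J where "J = (\<lambda>i. JC i \<times> {..<mS i})"
  define KN where "KN = (\<lambda>i s u v. \<phi> i (fst s) (fst u) * cnj (\<psi> i (fst s) (fst v)) * KS i (snd s) (snd u) (snd v))"
  have linN: "linear_map (P i) (Q i) (N i)" if "i \<in> I" for i
    unfolding P_def Q_def N_def using linC[OF that] linS[OF that] by (rule tensor_map_linear)
  have KN: "N i X = kmap (P i) (Q i) (J i) (KN i) X" if i: "i \<in> I" and X: "X \<in> ops (P i)" for i X
    unfolding P_def Q_def N_def J_def KN_def
    by (rule tensor_map_kmap[OF _ _ KC(1)[OF i] _ linC[OF i] linS[OF i] KC(2)[OF i] KS[OF i] X[unfolded P_def]])
      auto
  have finJ: "finite (J i)" if "i \<in> I" for i
    using KC(1)[OF that] by (simp add: J_def)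
  have finJs: "finite (PiE I J)" using I finJ by (rule finite_PiE)
  obtain mL KL where KL: "\<And>X. X \<in> ops (PiE I Q) \<Longrightarrow>
      \<Lambda> X = kmap (PiE I Q) (PiE I B) {..<mL::nat} (\<lambda>r f p. \<Prod>i\<in>I. KL r i (f i) (p i)) X"
    using locc_separable[OF locc I fin(2,3)] unfolding separable_def by blast

  \<comment> \<open>A label lists the branch of the protocol, the branches of all channels, and the
    branch of the encoder, nested as two applications of \<open>kmap_comp\<close> produce
    them.\<close>
  define Z where "Z = {..<mL} \<times> (PiE I J \<times> {..<mE})"
  define W where "W = (\<lambda>z f a. \<Sum>q\<in>PiE I Q. (\<Prod>i\<in>I. KL (fst z) i (f i) (q i)) *
      (\<Sum>p\<in>PiE I P. (\<Prod>i\<in>I. KN i (fst (snd z) i) (q i) (p i)) * KE (snd (snd z)) p a))"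
  have finZ: "finite Z" using finJs by (simp add: Z_def)
  have total: "at_receiver n d x \<rho> = kmap {..<d} (PiE I B) Z W \<rho>" if \<rho>: "\<rho> \<in> ops {..<d}" for \<rho>
  proof -
    have NE: "party_tensor I P N (E \<rho>) = kmap {..<d} (PiE I Q) (PiE I J \<times> {..<mE})
        (\<lambda>s q a. \<Sum>p\<in>PiE I P. (\<Prod>i\<in>I. KN i (fst s i) (q i) (p i)) * KE (snd s) p a) \<rho>"
    proof -
      have "party_tensor I P N (E \<rho>) = kmap (PiE I P) (PiE I Q) (PiE I J)
          (\<lambda>\<sigma> f p. \<Prod>i\<in>I. KN i (\<sigma> i) (f i) (p i)) (kmap {..<d} (PiE I P) {..<mE} KE \<rho>)"
        unfolding KE[OF \<rho>] using I fin(1) finJ linN KN kmap_ops by (rule party_tensor_kmap)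
      also have "\<dots> = kmap {..<d} (PiE I Q) (PiE I J \<times> {..<mE})
        (\<lambda>s q a. \<Sum>p\<in>PiE I P. (\<Prod>i\<in>I. KN i (fst s i) (q i) (p i)) * KE (snd s) p a) \<rho>"
        by (rule kmap_comp[OF _ _ finJs \<rho>]) auto
      finally show ?thesis .
    qed
    have "at_receiver n d x \<rho> = \<Lambda> (party_tensor I P N (E \<rho>))" using \<Lambda>[OF \<rho>] by simp
    also have "\<dots> = kmap {..<d} (PiE I B) Z W \<rho>"
      unfolding NE KL[OF kmap_ops] Z_def W_def
      by (rule kmap_comp[OF _ _ _ \<rho>]) (use finJs in auto)
    finally show ?thesis .
  qed
  \<comment> \<open>The basis strings of the joint output system: \<open>c\<close> at
    \<open>x\<close>, and 0 at the trivial outputs.\<close>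
  define out where "out c = (\<lambda>i\<in>I. if i = x then c else 0)" for c :: nat
  have out: "out c \<in> PiE I B" if "c < d" for c
    using that by (auto simp: out_def B_def output_sys_def)
  have sum_W: "(\<Sum>z\<in>Z. W z (out c) a * cnj (W z (out c') a')) = of_bool (c = a \<and> c' = a')"
    if "a \<in> {..<d}" "a' \<in> {..<d}" "c \<in> {..<d}" "c' \<in> {..<d}" for a a' c c'
  proof -
    have "(\<Sum>z\<in>Z. W z (out c) a * cnj (W z (out c') a')) = at_receiver n d x (op_unit a a') (out c) (out c')"
      using that out total[OF op_unit_ops, of a a'] by (simp add: kmap_unit)
    also have "\<dots> = of_bool (c = a \<and> c' = a')"
      using that out[of c] out[of c'] unfolding at_receiver_def B_def I_def[symmetric]
      by (simp add: op_unit_def out_def)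
    finally show ?thesis .
  qed
  have scalar: "W z (out c) a = of_bool (c = a) * W z (out 0) 0"
    if "z \<in> Z" "c < d" "a < d" for z c a
    using identity_kraus[where J = Z and A = "{..<d}" and W = "\<lambda>z c a. W z (out c) a"
        and j = z and b = c and a = a and c = 0] finZ sum_W that \<open>1 \<le> d\<close> by simp
  \<comment> \<open>Otherwise the identity channel would have entry 0 instead of 1 at the message
    label 0, which exists since \<open>1 \<le> d\<close>.\<close>
  have "\<exists>z\<in>Z. W z (out 0) 0 \<noteq> 0"
  proof (rule ccontr)
    assume "\<not> ?thesis"
    then have "(\<Sum>z\<in>Z. W z (out 0) 0 * cnj (W z (out 0) 0)) = 0" by simp
    then show False using sum_W[of 0 0 0 0] \<open>1 \<le> d\<close> by simp
  qed
  then obtain r \<sigma> e where z: "r < mL" "\<sigma> \<in> PiE I J" "e < mE" and nz: "W (r, \<sigma>, e) (out 0) 0 \<noteq> 0"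
    by (auto simp: Z_def)
  \<comment> \<open>Only the side-channel component of the label at \<open>x\<close> is varied; the
    rank-one branch of \<open>C x\<close> and all other branches stay those of the nonzero operator
    just found.\<close>
  let ?\<sigma> = "\<lambda>t. \<sigma>(x := (fst (\<sigma> x), t))"
  define l where "l = (\<lambda>t. W (r, ?\<sigma> t, e) (out 0) 0)"
  have zt: "(r, ?\<sigma> t, e) \<in> Z" if "t < mS x" for t
  proof -
    have "\<sigma> x \<in> J x" using PiE_mem[OF z(2), of x] by simp
    then show ?thesis
      using z that by (auto simp: Z_def J_def PiE_iff extensional_def mem_Times_iff)
  qed
  obtain L M where LM: "W (r, ?\<sigma> t, e) (out c) a = (\<Sum>s<d. \<Sum>b<d. L c s * KS x t s b * M b a)" for t c a
  proof -
    have PQ: "Q x = {..<k x} \<times> {..<d}" "P x = {..<h x} \<times> {..<d}"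
      by (simp_all add: P_def Q_def)
    obtain L M where LM: "\<And>S c a. branch_op I P Q x (KL r) (\<phi> x (fst (\<sigma> x))) (\<psi> x (fst (\<sigma> x)))
        (\<lambda>i. KN i (\<sigma> i)) (KE e) S c a = (\<Sum>s<d. \<Sum>b<d. L c s * S s b * M b a)"
      using branch_op_sandwich[of I x P Q, OF I x[folded I_def] fin(1,2) PQ] by blast
    have "W (r, ?\<sigma> t, e) (out c) a = (\<Sum>s<d. \<Sum>b<d. L c s * KS x t s b * M b a)" for t c a
      unfolding LM[symmetric] W_def branch_op_def fst_conv snd_conv
      by (intro sum.cong refl arg_cong2[where f = "(*)"] prod.cong) (auto simp: out_def KN_def)
    then show ?thesis by (rule that)
  qed
  have sandwich: "(\<Sum>s<d. \<Sum>b<d. L c s * KS x t s b * M b a) = of_bool (c = a) * l t"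
    if "c < d" "a < d" "t < mS x" for c a t
    unfolding LM[symmetric] l_def using that by (intro scalar[OF zt])
  define t\<^sub>0 where "t\<^sub>0 = snd (\<sigma> x)"
  have t0: "t\<^sub>0 < mS x" using PiE_mem[OF z(2), of x] by (auto simp: t\<^sub>0_def J_def)
  have "l t\<^sub>0 \<noteq> 0" using nz by (simp add: l_def t\<^sub>0_def)
  have proportional: "KS x t s b = (l t / l t\<^sub>0) * KS x t\<^sub>0 s b" if "t \<in> {..<mS x}" "s < d" "b < d" for t s b
    by (rule sandwich_proportional[where L = L and M = M and S = "KS x t\<^sub>0" and S' = "KS x t"])
      (use that t0 \<open>l t\<^sub>0 \<noteq> 0\<close> in \<open>simp_all add: sandwich\<close>)
  show ?thesis
    by (rule noiseless_of_proportional_kraus[where K = "KS x" and c = "\<lambda>t. l t / l t\<^sub>0" and K\<^sub>0 = "KS x t\<^sub>0",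
          OF S[OF x] finite_lessThan KS[OF x[folded I_def]] proportional])
qed


section \<open>Local measurements on product sums\<close>

definition phase :: "nat \<Rightarrow> nat \<Rightarrow> nat \<Rightarrow> complex" where
  "phase d j a = cis (2 * pi * real (j * a) / real d)"

text \<open>A geometric sum of z^j with z^d = 1. If z were 1 for distinct labels, their difference
  would be a nonzero multiple of \<open>d\<close>, although both lie below \<open>d\<close>.\<close>

lemma phase_orthogonal:
  assumes "a < d" "b < d"
  shows "(\<Sum>j<d. phase d j a * cnj (phase d j b)) = of_bool (a = b) * of_nat d"
proof -
  define z where "z = cis (2 * pi * (real a - real b) / real d)"
  have zj: "phase d j a * cnj (phase d j b) = z ^ j" for j
  proof -
    have "phase d j a * cnj (phase d j b) = cis (2 * pi * real (j * a) / real d - 2 * pi * real (j * b) / real d)"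
      by (simp add: phase_def cis_cnj cis_mult)
    also have "2 * pi * real (j * a) / real d - 2 * pi * real (j * b) / real d
        = real j * (2 * pi * (real a - real b) / real d)"
      by (simp add: algebra_simps diff_divide_distrib)
    finally show ?thesis by (simp only: z_def Complex.DeMoivre)
  qed
  show ?thesis
  proof (cases "a = b")
    case True
    then show ?thesis unfolding zj by (simp add: z_def)
  next
    case False
    have "z ^ d = cis (2 * pi * (real a - real b))"
      using assms by (simp add: z_def Complex.DeMoivre)
    also have "\<dots> = 1"
      using cis_multiple_2pi[of "real a - real b"] by simp
    finally have "z ^ d = 1" .
    moreover have "z \<noteq> 1"
    proof
      assume "z = 1"
      then have "cos (2 * pi * (real a - real b) / real d) = 1"
        by (simp add: z_def complex_eq_iff)
      then obtain m :: int where m: "2 * pi * (real a - real b) / real d = of_int m * 2 * pi"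
        unfolding cos_one_2pi_int by blast
      then have "(2 * pi) * (real a - real b) = (2 * pi) * (of_int m * real d)"
        using assms by (simp add: field_simps)
      then have "real a - real b = of_int m * real d"
        by (simp only: mult_cancel_left) simp
      then have "of_int (int a - int b) = (of_int (m * int d) :: real)"
        by simp
      then have eq: "int a - int b = m * int d"
        unfolding of_int_eq_iff .
      then have "m \<noteq> 0" using False by auto
      then have "int d \<le> \<bar>m * int d\<bar>" by (simp add: abs_mult mult_le_cancel_right1 flip: zero_less_abs_iff)
      then show False using eq assms by linarith
    qed
    ultimately show ?thesis
      using False geometric_sum[of z d] by (simp add: zj)
  qed
qed

lemma phase_unimodular: "phase d j a * cnj (phase d j a) = 1"
  by (simp add: phase_def cis_cnj cis_mult)

text \<open>A form of joint operators that local maps preserve factor by factor. All states of the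
  sufficiency protocol are kept in it, so the analysis reduces to one party and one term at a time.
  The guard on \<open>f\<close> and \<open>g\<close> is that of \<open>party_tensor\<close>.\<close>

definition product_sum ::
  "'i set \<Rightarrow> 's set \<Rightarrow> ('s \<Rightarrow> complex) \<Rightarrow> ('s \<Rightarrow> 'i \<Rightarrow> 'a oper) \<Rightarrow> ('i \<Rightarrow> 'a) oper" where
  "product_sum I S c Y = (\<lambda>f g. if f \<in> extensional I \<and> g \<in> extensional I
     then \<Sum>s\<in>S. c s * (\<Prod>i\<in>I. Y s i (f i) (g i)) else 0)"

lemma product_sum_cong:
  assumes "\<And>s f g. s \<in> S \<Longrightarrow> c s * (\<Prod>i\<in>I. Y s i (f i) (g i)) = c' s * (\<Prod>i\<in>I. Y' s i (f i) (g i))"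
  shows "product_sum I S c Y = product_sum I S c' Y'"
  unfolding product_sum_def by (intro ext if_cong refl sum.cong assms)

lemma product_sum_ops:
  assumes "finite I" "\<And>s i. s \<in> S \<Longrightarrow> i \<in> I \<Longrightarrow> Y s i \<in> ops (A i)"
  shows "product_sum I S c Y \<in> ops (PiE I A)"
proof -
  have "(\<Prod>i\<in>I. Y s i (f i) (g i)) = 0"
    if "s \<in> S" and fg: "f \<notin> PiE I A \<or> g \<notin> PiE I A" "f \<in> extensional I" "g \<in> extensional I" for s f g
  proof -
    obtain i where i: "i \<in> I" "f i \<notin> A i \<or> g i \<notin> A i"
      using fg by (auto simp: PiE_iff)
    then have "Y s i (f i) (g i) = 0"
      using assms(2)[OF that(1) i(1)] by (auto simp: ops_def)
    then show ?thesis using i assms(1) by auto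
  qed
  then have "product_sum I S c Y f g = 0" if "f \<notin> PiE I A \<or> g \<notin> PiE I A" for f g
    using that by (simp add: product_sum_def)
  then show ?thesis by (simp add: ops_def)
qed

text \<open>Multilinearity: once the sum over terms is moved outside, the double sum over strings
  factorises into the matrix-unit expansion of \<open>T i (Y s i)\<close> for each party.\<close>

lemma party_tensor_product_sum:
  assumes "finite I" "\<And>i. i \<in> I \<Longrightarrow> finite (A i)"
    and "\<And>i. i \<in> I \<Longrightarrow> linear_map (A i) (B i) (T i)"
    and "\<And>s i. s \<in> S \<Longrightarrow> i \<in> I \<Longrightarrow> Y s i \<in> ops (A i)"
  shows "party_tensor I A T (product_sum I S c Y) = product_sum I S c (\<lambda>s i. T i (Y s i))"
proof (intro ext)
  fix f g
  have "(\<Sum>p\<in>PiE I A. \<Sum>q\<in>PiE I A. product_sum I S c Y p q * (\<Prod>i\<in>I. T i (op_unit (p i) (q i)) (f i) (g i)))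
      = (\<Sum>p\<in>PiE I A. \<Sum>q\<in>PiE I A. \<Sum>s\<in>S. c s * (\<Prod>i\<in>I. Y s i (p i) (q i) * T i (op_unit (p i) (q i)) (f i) (g i)))"
    by (intro sum.cong refl)
      (auto simp: product_sum_def PiE_def sum_distrib_right prod.distrib mult.assoc)
  also have "\<dots> = (\<Sum>p\<in>PiE I A. \<Sum>s\<in>S. \<Sum>q\<in>PiE I A. c s * (\<Prod>i\<in>I. Y s i (p i) (q i) * T i (op_unit (p i) (q i)) (f i) (g i)))"
    by (intro sum.cong refl sum.swap)
  also have "\<dots> = (\<Sum>s\<in>S. \<Sum>p\<in>PiE I A. \<Sum>q\<in>PiE I A. c s * (\<Prod>i\<in>I. Y s i (p i) (q i) * T i (op_unit (p i) (q i)) (f i) (g i)))"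
    by (rule sum.swap)
  also have "\<dots> = (\<Sum>s\<in>S. c s * (\<Prod>i\<in>I. \<Sum>a\<in>A i. \<Sum>a'\<in>A i. Y s i a a' * T i (op_unit a a') (f i) (g i)))"
    by (simp only: sum_distrib_left prod_double_sum_PiE[OF assms(1,2)])
  also have "\<dots> = (\<Sum>s\<in>S. c s * (\<Prod>i\<in>I. T i (Y s i) (f i) (g i)))"
    by (intro sum.cong refl arg_cong2[where f = "(*)"] prod.cong)
      (use assms in \<open>simp add: linear_map_expand[OF assms(3) assms(2) assms(4), symmetric]\<close>)
  finally show "party_tensor I A T (product_sum I S c Y) f g = product_sum I S c (\<lambda>s i. T i (Y s i)) f g"
    by (simp add: party_tensor_def product_sum_def)
qed

text \<open>The output of \<open>C i\<close>, of dimension \<open>k\<close>, is traced out; it carries nothing in this protocol.\<close>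

definition discard_apply :: "nat \<Rightarrow> nat \<Rightarrow> 'b set \<Rightarrow> ('b \<Rightarrow> nat \<Rightarrow> complex) \<Rightarrow> (nat \<times> nat, 'b) superoper" where
  "discard_apply k d B V = kmap ({..<k} \<times> {..<d}) B {..<k} (\<lambda>r b u. of_bool (fst u = r) * V b (snd u))"

lemma discard_apply_eq:
  assumes "b \<in> B" "b' \<in> B"
  shows "discard_apply k d B V X b b'
    = (\<Sum>r<k. \<Sum>s<d. \<Sum>s'<d. V b s * X (r, s) (r, s') * cnj (V b' s'))"
proof -
  have "(\<Sum>u\<in>{..<k} \<times> {..<d}. \<Sum>v\<in>{..<k} \<times> {..<d}.
       (of_bool (fst u = r) * V b (snd u)) * X u v * cnj (of_bool (fst v = r) * V b' (snd v)))
     = (\<Sum>s<d. \<Sum>s'<d. V b s * X (r, s) (r, s') * cnj (V b' s'))" if "r < k" for r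
  proof -
    have "(\<Sum>v\<in>{..<k} \<times> {..<d}. (of_bool (fst u = r) * V b (snd u)) * X u v * cnj (of_bool (fst v = r) * V b' (snd v)))
      = (\<Sum>s'<d. (of_bool (fst u = r) * V b (snd u)) * X u (r, s') * cnj (of_bool (r = r) * V b' s'))" for u
      using that by (subst sum_Times_pick[where i = r]) auto
    moreover have "(\<Sum>u\<in>{..<k} \<times> {..<d}. \<Sum>s'<d. (of_bool (fst u = r) * V b (snd u)) * X u (r, s') * cnj (of_bool (r = r) * V b' s'))
      = (\<Sum>s<d. \<Sum>s'<d. (of_bool (r = r) * V b s) * X (r, s) (r, s') * cnj (of_bool (r = r) * V b' s'))"
      using that by (subst sum_Times_pick[where i = r]) auto
    ultimately show ?thesis by simp
  qed
  then show ?thesis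
    using assms by (simp add: discard_apply_def kmap_def)
qed

lemma discard_apply_cp: "cp_map ({..<k} \<times> {..<d}) B (discard_apply k d B V)"
  by (simp add: discard_apply_def kmap_cp)

lemma discard_apply_product:
  assumes "(\<Sum>r<k. \<tau> r r) = 1" "b \<in> B" "b' \<in> B"
  shows "discard_apply k d B V (\<lambda>u v. \<tau> (fst u) (fst v) * (\<alpha> (snd u) * cnj (\<beta> (snd v)))) b b'
    = (\<Sum>s<d. V b s * \<alpha> s) * cnj (\<Sum>s<d. V b' s * \<beta> s)"
proof -
  have "discard_apply k d B V (\<lambda>u v. \<tau> (fst u) (fst v) * (\<alpha> (snd u) * cnj (\<beta> (snd v)))) b b'
    = (\<Sum>r<k. \<tau> r r * (\<Sum>s<d. \<Sum>s'<d. (V b s * \<alpha> s) * cnj (V b' s' * \<beta> s')))"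
    unfolding discard_apply_eq[OF assms(2,3)] by (simp add: sum_distrib_left mult_ac)
  also have "\<dots> = (\<Sum>s<d. V b s * \<alpha> s) * cnj (\<Sum>s<d. V b' s * \<beta> s)"
    unfolding sum_distrib_right[symmetric] assms(1) cnj_sum sum_product by simp
  finally show ?thesis .
qed

text \<open>Serves two purposes: a one-element \<open>B\<close> with \<open>m\<close> outcomes gives
  a measurement, and \<open>m = 1\<close> gives a channel.\<close>

lemma discard_apply_trace:
  fixes m :: nat
  assumes V: "\<And>s s'. s < d \<Longrightarrow> s' < d \<Longrightarrow> (\<Sum>j<m. \<Sum>b\<in>B. V j b s * cnj (V j b s')) = of_bool (s = s')"
  shows "(\<Sum>j<m. op_trace B (discard_apply k d B (V j) X)) = op_trace ({..<k} \<times> {..<d}) X"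
proof -
  have "(\<Sum>j<m. op_trace B (discard_apply k d B (V j) X))
      = (\<Sum>j<m. \<Sum>b\<in>B. \<Sum>r<k. \<Sum>s<d. \<Sum>s'<d. V j b s * X (r, s) (r, s') * cnj (V j b s'))"
    by (simp add: op_trace_def discard_apply_eq)
  also have "\<dots> = (\<Sum>y\<in>{..<m} \<times> B. \<Sum>r<k. \<Sum>s<d. \<Sum>s'<d.
      V (fst y) (snd y) s * X (r, s) (r, s') * cnj (V (fst y) (snd y) s'))"
    by (subst sum.cartesian_product) (simp only: split_def)
  also have "\<dots> = (\<Sum>r<k. \<Sum>y\<in>{..<m} \<times> B. \<Sum>s<d. \<Sum>s'<d.
      V (fst y) (snd y) s * X (r, s) (r, s') * cnj (V (fst y) (snd y) s'))"
    by (rule sum.swap)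
  also have "\<dots> = (\<Sum>r<k. \<Sum>s<d. \<Sum>y\<in>{..<m} \<times> B. \<Sum>s'<d.
      V (fst y) (snd y) s * X (r, s) (r, s') * cnj (V (fst y) (snd y) s'))"
    by (intro sum.cong refl sum.swap)
  also have "\<dots> = (\<Sum>r<k. \<Sum>s<d. \<Sum>s'<d. \<Sum>y\<in>{..<m} \<times> B.
      V (fst y) (snd y) s * X (r, s) (r, s') * cnj (V (fst y) (snd y) s'))"
    by (intro sum.cong refl sum.swap)
  also have "\<dots> = (\<Sum>r<k. \<Sum>s<d. \<Sum>s'<d. of_bool (s = s') * X (r, s) (r, s'))"
  proof (intro sum.cong refl)
    fix r s s' assume *: "s \<in> {..<d}" "s' \<in> {..<d}"
    have "(\<Sum>y\<in>{..<m} \<times> B. V (fst y) (snd y) s * X (r, s) (r, s') * cnj (V (fst y) (snd y) s'))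
        = (\<Sum>j<m. \<Sum>b\<in>B. V j b s * cnj (V j b s')) * X (r, s) (r, s')"
      by (simp add: sum.cartesian_product split_def sum_distrib_left sum_distrib_right mult_ac)
    then show "(\<Sum>y\<in>{..<m} \<times> B. V (fst y) (snd y) s * X (r, s) (r, s') * cnj (V (fst y) (snd y) s'))
        = of_bool (s = s') * X (r, s) (r, s')"
      using V * by simp
  qed
  also have "\<dots> = (\<Sum>r<k. \<Sum>s<d. \<Sum>s'<d. if s' = s then X (r, s) (r, s) else 0)"
    by (intro sum.cong refl) auto
  also have "\<dots> = op_trace ({..<k} \<times> {..<d}) X"
    by (simp add: op_trace_def sum.cartesian_product split_def)
  finally show ?thesis .
qed

lemma unitary_adj_mult:
  assumes "unitary {..<d} U" "b < d" "b' < (d::nat)"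
  shows "(\<Sum>s<d. cnj (U s b) * U s b') = of_bool (b = b')"
proof -
  have "op_mult {..<d} (op_adj U) U b b' = op_id {..<d} b b'"
    using assms(1) by (simp add: unitary_def)
  then show ?thesis using assms(2) by (simp add: op_mult_def op_adj_def op_id_def)
qed

lemma unitary_mult_adj:
  assumes "unitary {..<d} U" "b < d" "b' < (d::nat)"
  shows "(\<Sum>s<d. U b s * cnj (U b' s)) = of_bool (b = b')"
proof -
  have "op_mult {..<d} U (op_adj U) b b' = op_id {..<d} b b'"
    using assms(1) by (simp add: unitary_def)
  then show ?thesis using assms(2) by (simp add: op_mult_def op_adj_def op_id_def)
qed


section \<open>Recovery of a copied message\<close>

text \<open>
  \<open>product_sum\<close> over \<open>s = (a, b)\<close> expands the joint state in the matrix units \<open>|a\<rangle>\<langle>b|\<close> of the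
  message; \<open>copy_state\<close> is the share of party \<open>i\<close> in the \<open>s\<close>-th term.
\<close>

definition copy_state :: "(nat \<Rightarrow> nat oper) \<Rightarrow> (nat \<Rightarrow> nat oper) \<Rightarrow> nat \<Rightarrow> nat \<times> nat \<Rightarrow> (nat \<times> nat) oper" where
  "copy_state \<tau> U i s = (\<lambda>u v. \<tau> i (fst u) (fst v) * (U i (snd u) (fst s) * cnj (U i (snd v) (snd s))))"

lemma copy_state_ops:
  assumes "\<tau> i \<in> ops {..<k}" "unitary {..<d} (U i)"
  shows "copy_state \<tau> U i s \<in> ops ({..<k} \<times> {..<d})"
  using assms by (auto simp: copy_state_def ops_def unitary_def mem_Times_iff)

lemma sum_diag_of_bool:
  assumes "a < (d::nat)"
  shows "(\<Sum>b<d. f b * of_bool (b = a)) = (f a :: complex)" "(\<Sum>b<d. f b * of_bool (a = b)) = f a"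
proof -
  have "(\<Sum>b<d. f b * of_bool (b = a)) = (\<Sum>b<d. if b = a then f b else 0)"
    by (intro sum.cong) auto
  then show "(\<Sum>b<d. f b * of_bool (b = a)) = f a" using assms by simp
  have "(\<Sum>b<d. f b * of_bool (a = b)) = (\<Sum>b<d. if a = b then f b else 0)"
    by (intro sum.cong) auto
  then show "(\<Sum>b<d. f b * of_bool (a = b)) = f a" using assms by simp
qed

text \<open>The j-th Fourier row vector times the adjoint of \<open>V\<close>: undoing the unitary
  and measuring are one step. A row vector is a matrix with a one-dimensional output, hence the
  label argument before \<open>s\<close>.\<close>

definition fourier_bra :: "nat \<Rightarrow> nat oper \<Rightarrow> nat \<Rightarrow> nat \<times> nat \<Rightarrow> nat \<Rightarrow> complex" where
  "fourier_bra d V j _ s = (\<Sum>a<d. phase d j a * cnj (V s a)) / of_real (sqrt (real d))"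

lemma fourier_bra_apply:
  assumes "unitary {..<d} V" "a < d"
  shows "(\<Sum>s<d. fourier_bra d V j b s * V s a) = phase d j a / of_real (sqrt (real d))"
proof -
  have "(\<Sum>s<d. fourier_bra d V j b s * V s a)
      = (\<Sum>s<d. \<Sum>a'<d. phase d j a' * (cnj (V s a') * V s a)) / of_real (sqrt (real d))"
    by (simp add: fourier_bra_def sum_divide_distrib sum_distrib_right mult.assoc)
  also have "(\<Sum>s<d. \<Sum>a'<d. phase d j a' * (cnj (V s a') * V s a))
      = (\<Sum>a'<d. phase d j a' * (\<Sum>s<d. cnj (V s a') * V s a))"
    unfolding sum_distrib_left by (rule sum.swap)
  also have "\<dots> = (\<Sum>a'<d. phase d j a' * of_bool (a' = a))"
    using assms by (intro sum.cong) (auto simp: unitary_adj_mult)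
  also have "\<dots> = phase d j a"
    using assms(2) by (rule sum_diag_of_bool)
  finally show ?thesis .
qed

text \<open>Summing over j first leaves \<open>d\<close> times the diagonal by orthogonality of the
  phases, which cancels the normalisation; the remaining sum is an entry of \<open>V\<close> times
  its adjoint.\<close>

lemma fourier_bra_complete:
  assumes "unitary {..<d} V" "s < d" "s' < d"
  shows "(\<Sum>j<d. fourier_bra d V j b s * cnj (fourier_bra d V j b s')) = of_bool (s = s')"
proof -
  have d: "complex_of_real (sqrt (real d)) * complex_of_real (sqrt (real d)) = of_nat d"
    by (metis of_real_mult of_real_of_nat_eq of_nat_0_le_iff real_sqrt_mult_self abs_of_nonneg)
  have "(\<Sum>j<d. fourier_bra d V j b s * cnj (fourier_bra d V j b s'))
      = (\<Sum>j<d. (\<Sum>a<d. phase d j a * cnj (V s a)) * (\<Sum>a'<d. cnj (phase d j a') * V s' a')) / of_nat d"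
  proof -
    have "fourier_bra d V j b s * cnj (fourier_bra d V j b s')
        = (\<Sum>a<d. phase d j a * cnj (V s a)) * cnj (\<Sum>a<d. phase d j a * cnj (V s' a)) / of_nat d" for j
      unfolding d[symmetric] fourier_bra_def by (simp del: cnj_sum)
    then show ?thesis by (simp add: sum_divide_distrib)
  qed
  also have "(\<Sum>j<d. (\<Sum>a<d. phase d j a * cnj (V s a)) * (\<Sum>a'<d. cnj (phase d j a') * V s' a'))
      = (\<Sum>j<d. \<Sum>a<d. \<Sum>a'<d. phase d j a * cnj (phase d j a') * (cnj (V s a) * V s' a'))"
    unfolding sum_product by (simp only: mult_ac)
  also have "(\<Sum>j<d. \<Sum>a<d. \<Sum>a'<d. phase d j a * cnj (phase d j a') * (cnj (V s a) * V s' a'))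
      = (\<Sum>a<d. \<Sum>j<d. \<Sum>a'<d. phase d j a * cnj (phase d j a') * (cnj (V s a) * V s' a'))"
    by (rule sum.swap)
  also have "\<dots> = (\<Sum>a<d. \<Sum>a'<d. \<Sum>j<d. phase d j a * cnj (phase d j a') * (cnj (V s a) * V s' a'))"
    by (intro sum.cong refl sum.swap)
  also have "\<dots> = (\<Sum>a<d. \<Sum>a'<d. cnj (V s a) * V s' a' * of_nat d * of_bool (a = a'))"
    unfolding sum_distrib_right[symmetric]
    by (intro sum.cong refl) (simp add: phase_orthogonal)
  also have "\<dots> = (\<Sum>a<d. V s' a * cnj (V s a)) * of_nat d"
    unfolding sum_distrib_right by (intro sum.cong refl, subst sum_diag_of_bool(2)) (simp_all add: mult_ac)
  also have "\<dots> = of_bool (s = s') * of_nat d"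
    using unitary_mult_adj[OF assms(1,3,2)] by auto
  finally show ?thesis using assms(2) by simp
qed

text \<open>After its measurement a party keeps the one-dimensional system \<open>{(0, 0)}\<close>,
  because intermediate systems in \<open>locc\<close> share the label type of the initial
  ones.\<close>

lemma fourier_instrument:
  assumes "unitary {..<d} V"
  shows "instrument ({..<k} \<times> {..<d}) {(0, 0)} d (\<lambda>j. discard_apply k d {(0, 0)} (fourier_bra d V j))"
  unfolding instrument_def
  by (auto simp: discard_apply_cp fourier_bra_complete[OF assms] intro!: discard_apply_trace)

text \<open>On the copy of a basis label a, the row vector takes the value of the phase over the
  square root of \<open>d\<close>: constant modulus, so only phases and the weight 1/d
  remain.\<close>

lemma fourier_measure_copy_state:
  assumes "unitary {..<d} (U i)" "(\<Sum>r<k. \<tau> i r r) = 1" "s \<in> {..<d} \<times> {..<d}"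
  shows "discard_apply k d {(0, 0)} (fourier_bra d (U i) j) (copy_state \<tau> U i s)
    = (\<lambda>u v. phase d j (fst s) * cnj (phase d j (snd s)) / of_nat d * op_unit (0, 0) (0, 0) u v)"
proof (intro ext)
  fix u v :: "nat \<times> nat"
  have d: "complex_of_real (sqrt (real d)) * complex_of_real (sqrt (real d)) = of_nat d"
    by (metis of_real_mult of_real_of_nat_eq of_nat_0_le_iff real_sqrt_mult_self abs_of_nonneg)
  show "discard_apply k d {(0, 0)} (fourier_bra d (U i) j) (copy_state \<tau> U i s) u v
    = phase d j (fst s) * cnj (phase d j (snd s)) / of_nat d * op_unit (0, 0) (0, 0) u v"
  proof (cases "u = (0, 0) \<and> v = (0, 0)")
    case True
    have "discard_apply k d {(0, 0)} (fourier_bra d (U i) j) (copy_state \<tau> U i s) (0, 0) (0, 0)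
      = phase d j (fst s) * cnj (phase d j (snd s)) / of_nat d"
    proof -
      have "discard_apply k d {(0, 0)} (fourier_bra d (U i) j) (copy_state \<tau> U i s) (0, 0) (0, 0)
        = (\<Sum>t<d. fourier_bra d (U i) j (0, 0) t * U i t (fst s)) *
          cnj (\<Sum>t<d. fourier_bra d (U i) j (0, 0) t * U i t (snd s))"
        unfolding copy_state_def by (rule discard_apply_product[of "\<tau> i", OF assms(2)]) auto
      also have "(\<Sum>t<d. fourier_bra d (U i) j (0, 0) t * U i t (fst s)) = phase d j (fst s) / of_real (sqrt (real d))"
        by (rule fourier_bra_apply[OF assms(1)]) (use assms(3) in auto)
      also have "(\<Sum>t<d. fourier_bra d (U i) j (0, 0) t * U i t (snd s)) = phase d j (snd s) / of_real (sqrt (real d))"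
        by (rule fourier_bra_apply[OF assms(1)]) (use assms(3) in auto)
      finally show ?thesis by (simp add: d)
    qed
    then show ?thesis using True by (simp add: op_unit_def)
  next
    case False
    then show ?thesis
      by (auto simp: discard_apply_def kmap_def op_unit_def)
  qed
qed

text \<open>The matrix is the adjoint of \<open>V\<close> followed by the inverse of the diagonal
  unitary \<open>D\<close>; receiver \<open>x\<close> undoes both its side-channel and the
  accumulated phases.\<close>

lemma correction_channel:
  assumes "unitary {..<d} V" "\<And>a. a < d \<Longrightarrow> D a * cnj (D a) = 1"
  shows "channel ({..<k} \<times> {..<d}) {..<d} (discard_apply k d {..<d} (\<lambda>c s. cnj (D c) * cnj (V s c)))"
proof -
  have "(\<Sum>c<d. (cnj (D c) * cnj (V s c)) * cnj (cnj (D c) * cnj (V s' c))) = of_bool (s = s')"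
    if "s < d" "s' < d" for s s'
  proof -
    have "(\<Sum>c<d. (cnj (D c) * cnj (V s c)) * cnj (cnj (D c) * cnj (V s' c)))
        = (\<Sum>c<d. (D c * cnj (D c)) * (V s' c * cnj (V s c)))"
      by (simp add: mult_ac)
    also have "\<dots> = (\<Sum>c<d. V s' c * cnj (V s c))"
      using assms(2) by simp
    also have "\<dots> = of_bool (s = s')"
      using unitary_mult_adj[OF assms(1) that(2,1)] by auto
    finally show ?thesis .
  qed
  then have "(\<Sum>j<1::nat. op_trace {..<d} (discard_apply k d {..<d} (\<lambda>c s. cnj (D c) * cnj (V s c)) X))
      = op_trace ({..<k} \<times> {..<d}) X" for X
    by (intro discard_apply_trace) simp
  then show ?thesis
    by (simp add: channel_def discard_apply_cp)
qed

text \<open>The scalar produced is the conjugate of the phase factor carried by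
  \<open>residual_state\<close>, so the two cancel.\<close>

lemma correct_copy_state:
  assumes "unitary {..<d} (U i)" "(\<Sum>r<k. \<tau> i r r) = 1" "s \<in> {..<d} \<times> {..<d}"
  shows "discard_apply k d {..<d} (\<lambda>c t. cnj (D c) * cnj (U i t c)) (copy_state \<tau> U i s)
    = (\<lambda>c c'. cnj (D (fst s)) * D (snd s) * op_unit (fst s) (snd s) c c')"
proof (intro ext)
  fix c c'
  have V: "(\<Sum>t<d. cnj (D c) * cnj (U i t c) * U i t a) = cnj (D a) * of_bool (c = a)"
    if "c < d" "a < d" for c a
    using unitary_adj_mult[OF assms(1) that] by (auto simp: mult.assoc sum_distrib_left[symmetric])
  show "discard_apply k d {..<d} (\<lambda>c t. cnj (D c) * cnj (U i t c)) (copy_state \<tau> U i s) c c'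
    = cnj (D (fst s)) * D (snd s) * op_unit (fst s) (snd s) c c'"
  proof (cases "c < d \<and> c' < d")
    case True
    have "discard_apply k d {..<d} (\<lambda>c t. cnj (D c) * cnj (U i t c)) (copy_state \<tau> U i s) c c'
        = (\<Sum>t<d. cnj (D c) * cnj (U i t c) * U i t (fst s)) *
          cnj (\<Sum>t<d. cnj (D c') * cnj (U i t c') * U i t (snd s))"
      unfolding copy_state_def
      by (rule discard_apply_product[of "\<tau> i", OF assms(2)]) (use True in auto)
    also have "(\<Sum>t<d. cnj (D c) * cnj (U i t c) * U i t (fst s)) = cnj (D (fst s)) * of_bool (c = fst s)"
      by (rule V) (use True assms(3) in auto)
    also have "(\<Sum>t<d. cnj (D c') * cnj (U i t c') * U i t (snd s)) = cnj (D (snd s)) * of_bool (c' = snd s)"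
      by (rule V) (use True assms(3) in auto)
    finally show ?thesis by (simp add: op_unit_def)
  next
    case False
    then show ?thesis
      using assms(3) by (auto simp: discard_apply_def kmap_def op_unit_def)
  qed
qed

lemma at_receiver_product_sum:
  assumes "x \<in> {1..n}" "\<rho> \<in> ops {..<d}" "1 \<le> d"
  shows "product_sum {1..n} ({..<d} \<times> {..<d}) (\<lambda>s. \<rho> (fst s) (snd s))
      (\<lambda>s i. if i = x then op_unit (fst s) (snd s) else op_unit 0 0) = at_receiver n d x \<rho>"
proof (intro ext)
  fix f g :: "nat \<Rightarrow> nat"
  let ?Y = "\<lambda>s i. if i = x then op_unit (fst s) (snd s) else op_unit (0::nat) 0"
  have "product_sum {1..n} ({..<d} \<times> {..<d}) (\<lambda>s. \<rho> (fst s) (snd s)) ?Y \<in> ops (PiE {1..n} (output_sys d x))"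
    by (rule product_sum_ops) (auto simp: output_sys_def op_unit_ops split: if_splits)
  moreover have "product_sum {1..n} ({..<d} \<times> {..<d}) (\<lambda>s. \<rho> (fst s) (snd s)) ?Y f g = \<rho> (f x) (g x)"
    if fg: "f \<in> PiE {1..n} (output_sys d x)" "g \<in> PiE {1..n} (output_sys d x)"
  proof -
    have fx: "f x < d" "g x < d" and f0: "\<And>i. i \<in> {1..n} - {x} \<Longrightarrow> f i = 0 \<and> g i = 0"
      using fg assms(1) by (force simp: PiE_iff output_sys_def split: if_splits)+
    have "(\<Prod>i\<in>{1..n}. ?Y s i (f i) (g i)) = of_bool (s = (f x, g x))" for s
    proof -
      have "(\<Prod>i\<in>{1..n}. ?Y s i (f i) (g i))
          = op_unit (fst s) (snd s) (f x) (g x) * (\<Prod>i\<in>{1..n} - {x}. ?Y s i (f i) (g i))"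
        using prod.remove[of "{1..n}" x "\<lambda>i. ?Y s i (f i) (g i)"] assms(1) by simp
      also have "(\<Prod>i\<in>{1..n} - {x}. ?Y s i (f i) (g i)) = 1"
        by (rule prod.neutral) (use f0 in \<open>auto simp: op_unit_def\<close>)
      finally show ?thesis by (auto simp: op_unit_def prod_eq_iff)
    qed
    then have "product_sum {1..n} ({..<d} \<times> {..<d}) (\<lambda>s. \<rho> (fst s) (snd s)) ?Y f g
        = (\<Sum>s\<in>{..<d} \<times> {..<d}. if s = (f x, g x) then \<rho> (fst s) (snd s) else 0)"
      using fg by (auto simp: product_sum_def PiE_def intro!: sum.cong)
    also have "\<dots> = \<rho> (f x) (g x)" using fx by simp
    finally show ?thesis .
  qed
  ultimately show "product_sum {1..n} ({..<d} \<times> {..<d}) (\<lambda>s. \<rho> (fst s) (snd s)) ?Y f g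
      = at_receiver n d x \<rho> f g"
    unfolding at_receiver_def ops_def by (cases "f \<in> PiE {1..n} (output_sys d x) \<and> g \<in> PiE {1..n} (output_sys d x)") auto
qed

text \<open>Moves a scalar arising at one party into the global coefficient of a term.\<close>

lemma prod_scale_at:
  fixes F :: "'i \<Rightarrow> complex"
  assumes "finite I" "y \<in> I"
  shows "(\<Prod>i\<in>I. if i = y then z * F i else F i) = z * (\<Prod>i\<in>I. F i)"
proof -
  have "(\<Prod>i\<in>I. if i = y then z * F i else F i) = (\<Prod>i\<in>I. (if i = y then z else 1) * F i)"
    by (intro prod.cong) auto
  then show ?thesis using assms by (simp add: prod.distrib)
qed

text \<open>
  The joint state when the parties outside \<open>insert x J\<close> have measured: their outcomes have only
  left the known phases \<open>D\<close> on the copied message.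
\<close>

definition residual_state ::
  "(nat \<Rightarrow> nat oper) \<Rightarrow> (nat \<Rightarrow> nat oper) \<Rightarrow> nat \<Rightarrow> nat \<Rightarrow> nat \<Rightarrow> nat set \<Rightarrow> (nat \<Rightarrow> complex) \<Rightarrow>
    (nat, nat \<Rightarrow> nat \<times> nat) superoper" where
  "residual_state \<tau> U n d x J D \<rho> = product_sum {1..n} ({..<d} \<times> {..<d})
     (\<lambda>s. \<rho> (fst s) (snd s) * (D (fst s) * cnj (D (snd s))))
     (\<lambda>s i. if i \<in> {1..n} - insert x J then op_unit (0, 0) (0, 0) else copy_state \<tau> U i s)"

definition residual_sys ::
  "(nat \<Rightarrow> nat) \<Rightarrow> nat \<Rightarrow> nat \<Rightarrow> nat \<Rightarrow> nat set \<Rightarrow> nat \<Rightarrow> (nat \<times> nat) set" where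
  "residual_sys k n d x J = (\<lambda>i. if i \<in> {1..n} - insert x J then {(0, 0)} else {..<k i} \<times> {..<d})"

lemma residual_sys_finite: "finite (residual_sys k n d x J i)"
  by (simp add: residual_sys_def)

lemma residual_factor_ops:
  assumes "\<And>i. i \<in> {1..n} \<Longrightarrow> \<tau> i \<in> ops {..<k i}" "\<And>i. i \<in> {1..n} \<Longrightarrow> unitary {..<d} (U i)" "i \<in> {1..n}"
  shows "(if i \<in> {1..n} - insert x J then op_unit (0, 0) (0, 0) else copy_state \<tau> U i s)
    \<in> ops (residual_sys k n d x J i)"
  using assms by (auto simp: residual_sys_def op_unit_ops intro: copy_state_ops)

text \<open>Induction on the set \<open>J\<close> of parties that still have to measure.
  \<open>D\<close> is generalised since every outcome multiplies it by a further phase, and it is an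
  argument of the protocol because the outcomes are announced.\<close>

lemma locc_recover:
  fixes J :: "nat set"
  assumes "finite J" "J \<subseteq> {1..n} - {x}" and x: "x \<in> {1..n}" and "1 \<le> d"
    and \<tau>: "\<And>i. i \<in> {1..n} \<Longrightarrow> \<tau> i \<in> ops {..<k i}"
    and \<tau>1: "\<And>i. i \<in> {1..n} \<Longrightarrow> (\<Sum>r<k i. \<tau> i r r) = 1"
    and U: "\<And>i. i \<in> {1..n} \<Longrightarrow> unitary {..<d} (U i)"
    and D: "\<And>a. D a * cnj (D a) = 1"
  shows "\<exists>\<Lambda>. locc {1..n} (residual_sys k n d x J) (output_sys d x) \<Lambda> \<and>
    (\<forall>\<rho>\<in>ops {..<d}. \<Lambda> (residual_state \<tau> U n d x J D \<rho>) = at_receiver n d x \<rho>)"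
  using assms(1,2) D
proof (induction J arbitrary: D rule: finite_induct)
  case empty
  let ?A = "residual_sys k n d x {}"
  \<comment> \<open>For the other parties the channel merely relabels the one-dimensional system
    left by the measurement as the prescribed trivial output.\<close>
  let ?T = "\<lambda>i. if i = x then discard_apply (k x) d {..<d} (\<lambda>c s. cnj (D c) * cnj (U x s c))
      else kmap {(0, 0)} {..<1::nat} {()} (\<lambda>_ _ _. 1)"
  let ?Y = "\<lambda>s i. if i \<in> {1..n} - {x} then op_unit (0, 0) (0, 0) else copy_state \<tau> U i s"
  have ch: "channel (?A i) (output_sys d x i) (?T i)" if "i \<in> {1..n}" for i
  proof (cases "i = x")
    case True
    then show ?thesis
      using correction_channel[OF U[OF x] empty.prems(2)] by (simp add: residual_sys_def output_sys_def)
  next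
    case False
    then show ?thesis
      using that by (simp add: residual_sys_def output_sys_def channel_def kmap_cp op_trace_def kmap_def)
  qed
  have "locc {1..n} ?A (output_sys d x) (party_tensor {1..n} ?A ?T)"
    by (rule locc.final[OF ch]) auto
  moreover have "party_tensor {1..n} ?A ?T (residual_state \<tau> U n d x {} D \<rho>) = at_receiver n d x \<rho>"
    if \<rho>: "\<rho> \<in> ops {..<d}" for \<rho>
  proof -
    have "party_tensor {1..n} ?A ?T (residual_state \<tau> U n d x {} D \<rho>)
        = product_sum {1..n} ({..<d} \<times> {..<d}) (\<lambda>s. \<rho> (fst s) (snd s) * (D (fst s) * cnj (D (snd s))))
            (\<lambda>s i. ?T i (?Y s i))"
      unfolding residual_state_def
    proof (rule party_tensor_product_sum)
      show "linear_map (?A i) (output_sys d x i) (?T i)" if "i \<in> {1..n}" for i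
        using ch[OF that] by (simp only: channel_def cp_map_def)
      show "?Y s i \<in> ops (?A i)" if "i \<in> {1..n}" for s i
        using residual_factor_ops[OF \<tau> U that] .
    qed (simp_all add: residual_sys_finite)
    also have "\<dots> = product_sum {1..n} ({..<d} \<times> {..<d}) (\<lambda>s. \<rho> (fst s) (snd s))
      (\<lambda>s i. if i = x then op_unit (fst s) (snd s) else op_unit 0 0)"
    proof (rule product_sum_cong)
      fix s f g assume s: "s \<in> {..<d} \<times> {..<d}"
      let ?F = "\<lambda>i. (if i = x then op_unit (fst s) (snd s) else op_unit 0 0) (f i) (g i)"
      have "(\<Prod>i\<in>{1..n}. ?T i (?Y s i) (f i) (g i))
          = (\<Prod>i\<in>{1..n}. if i = x then (cnj (D (fst s)) * D (snd s)) * ?F i else ?F i)"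
      proof (intro prod.cong refl)
        fix i assume i: "i \<in> {1..n}"
        show "?T i (?Y s i) (f i) (g i) = (if i = x then (cnj (D (fst s)) * D (snd s)) * ?F i else ?F i)"
        proof (cases "i = x")
          case True
          then show ?thesis
            using correct_copy_state[of d U x \<tau> "k x" s D, OF U[OF x] \<tau>1[OF x] s] by simp
        next
          case False
          then show ?thesis using i by (auto simp: kmap_def op_unit_def)
        qed
      qed
      also have "\<dots> = (cnj (D (fst s)) * D (snd s)) * (\<Prod>i\<in>{1..n}. ?F i)"
        using x by (intro prod_scale_at) auto
      finally have "(\<Prod>i\<in>{1..n}. ?T i (?Y s i) (f i) (g i)) = (cnj (D (fst s)) * D (snd s)) * (\<Prod>i\<in>{1..n}. ?F i)" .
      then have "\<rho> (fst s) (snd s) * (D (fst s) * cnj (D (snd s))) * (\<Prod>i\<in>{1..n}. ?T i (?Y s i) (f i) (g i))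
          = \<rho> (fst s) (snd s) * (D (fst s) * cnj (D (fst s))) * (D (snd s) * cnj (D (snd s))) * (\<Prod>i\<in>{1..n}. ?F i)"
        by (simp only: mult_ac)
      then show "\<rho> (fst s) (snd s) * (D (fst s) * cnj (D (snd s))) * (\<Prod>i\<in>{1..n}. ?T i (?Y s i) (f i) (g i))
          = \<rho> (fst s) (snd s) * (\<Prod>i\<in>{1..n}. ?F i)"
        by (simp only: empty.prems(2) mult_1_right)
    qed
    also have "\<dots> = at_receiver n d x \<rho>"
      using x \<rho> \<open>1 \<le> d\<close> by (rule at_receiver_product_sum)
    finally show ?thesis .
  qed
  ultimately show ?case by blast
next
  case (insert y J)
  let ?A = "residual_sys k n d x (insert y J)"
  let ?D = "\<lambda>j a. D a * phase d j a"
  have y: "y \<in> {1..n}" "y \<noteq> x" "y \<notin> J" and J: "J \<subseteq> {1..n} - {x}"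
    using insert by auto
  have "?D j a * cnj (?D j a) = 1" for j a
  proof -
    have "?D j a * cnj (?D j a) = (D a * cnj (D a)) * (phase d j a * cnj (phase d j a))"
      by (simp only: complex_cnj_mult mult_ac)
    then show ?thesis by (simp only: insert.prems(2) phase_unimodular mult_1_right)
  qed
  \<comment> \<open>One continuation per outcome j of party \<open>y\<close>.\<close>
  from insert.IH[OF J this] have "\<exists>\<Lambda>. \<forall>j. locc {1..n} (residual_sys k n d x J) (output_sys d x) (\<Lambda> j) \<and>
      (\<forall>\<rho>\<in>ops {..<d}. \<Lambda> j (residual_state \<tau> U n d x J (?D j) \<rho>) = at_receiver n d x \<rho>)"
    by (intro choice allI)
  then obtain \<Lambda> where \<Lambda>: "\<And>j. locc {1..n} (residual_sys k n d x J) (output_sys d x) (\<Lambda> j)"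
    "\<And>j \<rho>. \<rho> \<in> ops {..<d} \<Longrightarrow> \<Lambda> j (residual_state \<tau> U n d x J (?D j) \<rho>) = at_receiver n d x \<rho>"
    by blast
  let ?F = "\<lambda>j. discard_apply (k y) d {(0, 0)} (fourier_bra d (U y) j)"
  let ?\<Lambda> = "\<lambda>X f g. \<Sum>j<d. \<Lambda> j (party_tensor {1..n} ?A ((\<lambda>i Y. Y)(y := ?F j)) X) f g"
  have Ay: "?A y = {..<k y} \<times> {..<d}" and AJ: "?A(y := {(0, 0)}) = residual_sys k n d x J"
    using y by (auto simp: residual_sys_def fun_eq_iff)
  have "locc {1..n} ?A (output_sys d x) ?\<Lambda>"
  proof (rule locc.round[of y])
    show "instrument (?A y) {(0, 0)} d ?F"
      unfolding Ay by (rule fourier_instrument[OF U[OF y(1)]])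
    show "locc {1..n} (?A(y := {(0, 0)})) (output_sys d x) (\<Lambda> j)" for j
      unfolding AJ by (rule \<Lambda>(1))
  qed (use y in auto)
  moreover have "?\<Lambda> (residual_state \<tau> U n d x (insert y J) D \<rho>) = at_receiver n d x \<rho>"
    if \<rho>: "\<rho> \<in> ops {..<d}" for \<rho>
  proof -
    \<comment> \<open>Each of the \<open>d\<close> outcomes has weight 1/d. The weight is put on the
      message, which the induction hypothesis permits because it speaks of all operators and not
      just of density operators; summing the \<open>d\<close> equal results restores the
      message.\<close>
    let ?\<rho> = "\<lambda>a b. \<rho> a b / of_nat d"
    have \<rho>': "?\<rho> \<in> ops {..<d}" using \<rho> by (auto simp: ops_def)
    let ?Y = "\<lambda>s i. if i \<in> {1..n} - insert x (insert y J) then op_unit (0, 0) (0, 0) else copy_state \<tau> U i s"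
    have "party_tensor {1..n} ?A ((\<lambda>i Y. Y)(y := ?F j)) (residual_state \<tau> U n d x (insert y J) D \<rho>)
        = residual_state \<tau> U n d x J (?D j) ?\<rho>" for j
    proof -
      have "party_tensor {1..n} ?A ((\<lambda>i Y. Y)(y := ?F j)) (residual_state \<tau> U n d x (insert y J) D \<rho>)
          = product_sum {1..n} ({..<d} \<times> {..<d}) (\<lambda>s. \<rho> (fst s) (snd s) * (D (fst s) * cnj (D (snd s))))
              (\<lambda>s i. ((\<lambda>i Y. Y)(y := ?F j)) i (?Y s i))"
        unfolding residual_state_def
      proof (rule party_tensor_product_sum)
        show "linear_map (?A i) ((?A(y := {(0, 0)})) i) (((\<lambda>i Y. Y)(y := ?F j)) i)" for i
        proof (cases "i = y")
          case True
          then show ?thesis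
            using discard_apply_cp[of "k y" d "{(0, 0)}" "fourier_bra d (U y) j"] Ay
            by (simp add: cp_map_def)
        next
          case False
          then show ?thesis by (simp add: linear_map_def)
        qed
        show "?Y s i \<in> ops (?A i)" if "i \<in> {1..n}" for s i
          using residual_factor_ops[OF \<tau> U that] .
      qed (simp_all add: residual_sys_finite)
      also have "\<dots> = residual_state \<tau> U n d x J (?D j) ?\<rho>"
        unfolding residual_state_def
      proof (rule product_sum_cong)
        fix s f g assume s: "s \<in> {..<d} \<times> {..<d}"
        let ?G = "\<lambda>i. (if i \<in> {1..n} - insert x J then op_unit (0, 0) (0, 0) else copy_state \<tau> U i s) (f i) (g i)"
        let ?z = "phase d j (fst s) * cnj (phase d j (snd s)) / of_nat d"
        have "(\<Prod>i\<in>{1..n}. ((\<lambda>i Y. Y)(y := ?F j)) i (?Y s i) (f i) (g i))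
            = (\<Prod>i\<in>{1..n}. if i = y then ?z * ?G i else ?G i)"
        proof (intro prod.cong refl)
          fix i assume i: "i \<in> {1..n}"
          show "((\<lambda>i Y. Y)(y := ?F j)) i (?Y s i) (f i) (g i) = (if i = y then ?z * ?G i else ?G i)"
          proof (cases "i = y")
            case True
            then show ?thesis
              using fourier_measure_copy_state[of d U y \<tau> "k y" s j, OF U[OF y(1)] \<tau>1[OF y(1)] s] y by simp
          qed simp
        qed
        also have "\<dots> = ?z * (\<Prod>i\<in>{1..n}. ?G i)"
          using y by (intro prod_scale_at) auto
        finally have eq: "(\<Prod>i\<in>{1..n}. ((\<lambda>i Y. Y)(y := ?F j)) i (?Y s i) (f i) (g i)) = ?z * (\<Prod>i\<in>{1..n}. ?G i)" .
        show "\<rho> (fst s) (snd s) * (D (fst s) * cnj (D (snd s))) *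
            (\<Prod>i\<in>{1..n}. ((\<lambda>i Y. Y)(y := ?F j)) i (?Y s i) (f i) (g i))
          = ?\<rho> (fst s) (snd s) * (?D j (fst s) * cnj (?D j (snd s))) * (\<Prod>i\<in>{1..n}. ?G i)"
          unfolding eq by simp
      qed
      finally show ?thesis .
    qed
    then have "?\<Lambda> (residual_state \<tau> U n d x (insert y J) D \<rho>) = (\<lambda>f g. \<Sum>j<d. at_receiver n d x ?\<rho> f g)"
      by (simp only: \<Lambda>(2)[OF \<rho>'])
    also have "\<dots> = at_receiver n d x \<rho>"
      using \<open>1 \<le> d\<close> by (simp add: at_receiver_def fun_eq_iff)
    finally show ?thesis .
  qed
  ultimately show ?case by blast
qed

section \<open>The copying encoder and the sufficiency direction\<close>

lemma ops_outside: "X \<in> ops A \<Longrightarrow> \<not> (i \<in> A \<and> j \<in> A) \<Longrightarrow> X i j = 0"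
  by (auto simp: ops_def)

lemma op_unit_of_bool: "op_unit p q i j = of_bool (i = p) * of_bool (j = q)"
  by (simp add: op_unit_def)

lemma prod_of_bool:
  assumes "finite I"
  shows "(\<Prod>i\<in>I. of_bool (R i) :: complex) = of_bool (\<forall>i\<in>I. R i)"
  using assms by (induction I rule: finite_induct) auto

lemma sum_unit: "(\<Sum>j\<in>{()}. f j) = f ()"
  by simp

lemma kmap_unit_index:
  assumes "b \<in> B" "b' \<in> B"
  shows "kmap A B {()} K X b b' = (\<Sum>a\<in>A. \<Sum>a'\<in>A. K () b a * X a a' * cnj (K () b' a'))"
  using assms by (simp add: kmap_def)

lemma cnj_of_bool: "cnj (of_bool P) = of_bool P"
  by (cases P) simp_all

text \<open>An isometry, hence a single Kraus operator. Each \<open>C i\<close> is fed the fixed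
  basis vector 0.\<close>

definition copy_encoding :: "nat \<Rightarrow> nat \<Rightarrow> (nat \<Rightarrow> nat) \<Rightarrow> (nat, nat \<Rightarrow> nat \<times> nat) superoper" where
  "copy_encoding d n h = kmap {..<d} (PiE {1..n} (\<lambda>i. {..<h i} \<times> {..<d})) {()}
     (\<lambda>_ p a. of_bool (p = (\<lambda>i\<in>{1..n}. (0, a))))"

lemma copy_encoding_product_sum:
  assumes h: "\<And>i. i \<in> {1..n} \<Longrightarrow> 1 \<le> h i"
  shows "copy_encoding d n h \<rho> = product_sum {1..n} ({..<d} \<times> {..<d}) (\<lambda>s. \<rho> (fst s) (snd s))
    (\<lambda>s i. op_unit (0, fst s) (0, snd s))"
proof (intro ext)
  fix f g :: "nat \<Rightarrow> nat \<times> nat"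
  let ?P = "PiE {1..n} (\<lambda>i. {..<h i} \<times> {..<d})" and ?v = "\<lambda>a. (\<lambda>i\<in>{1..n}. (0::nat, a::nat))"
  have ext: "f = ?v a \<longleftrightarrow> (\<forall>i\<in>{1..n}. f i = (0, a))" if "f \<in> extensional {1..n}" for f a
    using that by (auto simp: extensional_def fun_eq_iff restrict_def)
  have prod: "(\<Prod>i\<in>{1..n}. op_unit (0, a) (0, b) (f i) (g i)) = of_bool (f = ?v a) * of_bool (g = ?v b)"
    if "f \<in> extensional {1..n}" "g \<in> extensional {1..n}" for a b
    by (simp only: op_unit_of_bool prod.distrib prod_of_bool[OF finite_atLeastAtMost] ext[OF that(1)] ext[OF that(2)])
  show "copy_encoding d n h \<rho> f g = product_sum {1..n} ({..<d} \<times> {..<d}) (\<lambda>s. \<rho> (fst s) (snd s))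
      (\<lambda>s i. op_unit (0, fst s) (0, snd s)) f g"
  proof (cases "f \<in> ?P \<and> g \<in> ?P")
    case True
    then have e: "f \<in> extensional {1..n}" "g \<in> extensional {1..n}" by (auto simp: PiE_def)
    have "product_sum {1..n} ({..<d} \<times> {..<d}) (\<lambda>s. \<rho> (fst s) (snd s)) (\<lambda>s i. op_unit (0, fst s) (0, snd s)) f g
        = (\<Sum>s\<in>{..<d} \<times> {..<d}. of_bool (f = ?v (fst s)) * \<rho> (fst s) (snd s) * of_bool (g = ?v (snd s)))"
      unfolding product_sum_def using e by (simp only: prod simp_thms if_True mult_ac)
    also have "\<dots> = (\<Sum>a<d. \<Sum>b<d. of_bool (f = ?v a) * \<rho> a b * of_bool (g = ?v b))"
      by (simp only: sum.cartesian_product split_def)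
    also have "\<dots> = copy_encoding d n h \<rho> f g"
      by (simp only: copy_encoding_def kmap_unit_index[OF conjunct1[OF True] conjunct2[OF True]] cnj_of_bool)
    finally show ?thesis ..
  next
    case False
    then have "copy_encoding d n h \<rho> f g = 0"
      unfolding copy_encoding_def by (rule kmap_outside)
    \<comment> \<open>Here \<open>1 \<le> h i\<close> makes \<open>(0, a)\<close> a label of the
      input system of party \<open>i\<close>.\<close>
    moreover have "product_sum {1..n} ({..<d} \<times> {..<d}) (\<lambda>s. \<rho> (fst s) (snd s))
        (\<lambda>s i. op_unit (0, fst s) (0, snd s)) f g = 0"
      by (rule ops_outside[OF product_sum_ops False])
        (use h in \<open>auto intro!: op_unit_ops simp: Suc_le_eq\<close>)
    ultimately show ?thesis by simp
  qed
qed

lemma copy_encoding_channel: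
  assumes "1 \<le> n" and h: "\<And>i. i \<in> {1..n} \<Longrightarrow> 1 \<le> h i"
  shows "channel {..<d} (PiE {1..n} (\<lambda>i. {..<h i} \<times> {..<d})) (copy_encoding d n h)"
proof -
  let ?P = "PiE {1..n} (\<lambda>i. {..<h i} \<times> {..<d})"
  define v where "v a = (\<lambda>i\<in>{1..n}. (0::nat, a::nat))" for a
  have v: "v a \<in> ?P" if "a < d" for a
    using that h by (auto simp: v_def Suc_le_eq)
  \<comment> \<open>Position 1 exists because \<open>1 \<le> n\<close>, and it displays the copied
    label. Injectivity is what makes the copying trace-preserving.\<close>
  have inj: "v a = v b \<longleftrightarrow> a = b" for a b
  proof
    assume "v a = v b"
    then have "v a 1 = v b 1" by (simp only:)
    then show "a = b" using assms(1) by (simp add: v_def)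
  qed simp
  have fin: "finite ?P" by (intro finite_PiE) auto
  have "op_trace ?P (copy_encoding d n h X) = op_trace {..<d} X" for X
  proof -
    have "op_trace ?P (copy_encoding d n h X)
        = (\<Sum>p\<in>?P. \<Sum>a<d. \<Sum>b<d. of_bool (p = v a) * X a b * of_bool (p = v b))"
      by (simp only: op_trace_def copy_encoding_def kmap_def v_def simp_thms if_True cnj_of_bool
          sum_unit cong: sum.cong)
    also have "\<dots> = (\<Sum>a<d. \<Sum>p\<in>?P. \<Sum>b<d. of_bool (p = v a) * X a b * of_bool (p = v b))"
      by (rule sum.swap)
    also have "\<dots> = (\<Sum>a<d. \<Sum>b<d. \<Sum>p\<in>?P. of_bool (p = v a) * X a b * of_bool (p = v b))"
      by (intro sum.cong refl sum.swap)
    also have "\<dots> = (\<Sum>a<d. \<Sum>b<d. X a b * of_bool (b = a))"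
    proof (intro sum.cong refl)
      fix a b assume "a \<in> {..<d}"
      have "(\<Sum>p\<in>?P. of_bool (p = v a) * X a b * of_bool (p = v b))
          = (\<Sum>p\<in>?P. if p = v a then X a b * of_bool (b = a) else 0)"
        by (intro sum.cong refl) (auto simp: inj)
      also have "\<dots> = X a b * of_bool (b = a)"
        using fin v[of a] \<open>a \<in> {..<d}\<close> by (simp only: sum.delta lessThan_iff if_True)
      finally show "(\<Sum>p\<in>?P. of_bool (p = v a) * X a b * of_bool (p = v b)) = X a b * of_bool (b = a)" .
    qed
    also have "\<dots> = op_trace {..<d} X"
      unfolding op_trace_def by (intro sum.cong refl sum_diag_of_bool) auto
    finally show ?thesis .
  qed
  then show ?thesis
    by (simp add: channel_def copy_encoding_def kmap_cp)
qed

lemma noiseless_unit: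
  assumes "unitary {..<d} U" "\<forall>X\<in>ops {..<d}. \<Phi> X = op_mult {..<d} (op_mult {..<d} U X) (op_adj U)"
    "a < d" "b < (d::nat)"
  shows "\<Phi> (op_unit a b) s s' = U s a * cnj (U s' b)"
proof -
  have "\<Phi> (op_unit a b) s s' = (\<Sum>l<d. \<Sum>m<d. U s m * op_unit a b m l * cnj (U s' l))"
    using assms(2,3,4) op_unit_ops[of a "{..<d}" b]
    by (simp add: op_mult_def op_adj_def sum_distrib_right)
  also have "\<dots> = (\<Sum>l<d. \<Sum>m<d. (of_bool (l = b) * cnj (U s' l) * U s m) * of_bool (m = a))"
    by (intro sum.cong refl) (auto simp: op_unit_def)
  also have "\<dots> = (\<Sum>l<d. (U s a * cnj (U s' l)) * of_bool (l = b))"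
    unfolding sum_diag_of_bool(1)[OF assms(3)] by (simp only: mult_ac)
  also have "\<dots> = U s a * cnj (U s' b)"
    using assms(4) by (rule sum_diag_of_bool)
  finally show ?thesis .
qed

lemma noiseless_imp_rrqc_possible:
  fixes d n :: nat and h k :: "nat \<Rightarrow> nat" and C S :: "nat \<Rightarrow> (nat, nat) superoper"
  assumes "1 \<le> d" "1 \<le> n"
    and h: "\<And>i. i \<in> {1..n} \<Longrightarrow> 1 \<le> h i"
    and C: "\<And>i. i \<in> {1..n} \<Longrightarrow> channel {..<h i} {..<k i} (C i)"
    and S: "\<And>i. i \<in> {1..n} \<Longrightarrow> channel {..<d} {..<d} (S i)"
    and noiseless: "\<And>i. i \<in> {1..n} \<Longrightarrow> noiseless {..<d} (S i)"
  shows "rrqc_possible d n (\<lambda>i. {..<h i} \<times> {..<d}) (\<lambda>i. {..<k i} \<times> {..<d})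
           (\<lambda>i. tensor_map {..<h i} {..<d} (C i) (S i))"
proof -
  let ?P = "\<lambda>i. {..<h i} \<times> {..<d}" and ?Q = "\<lambda>i. {..<k i} \<times> {..<d}"
  let ?N = "\<lambda>i. tensor_map {..<h i} {..<d} (C i) (S i)"
  have "\<exists>U. \<forall>i\<in>{1..n}. unitary {..<d} (U i) \<and>
      (\<forall>X\<in>ops {..<d}. S i X = op_mult {..<d} (op_mult {..<d} (U i) X) (op_adj (U i)))"
    by (rule bchoice) (use noiseless in \<open>simp add: noiseless_def\<close>)
  then obtain U where U: "\<And>i. i \<in> {1..n} \<Longrightarrow> unitary {..<d} (U i)"
    "\<And>i. i \<in> {1..n} \<Longrightarrow> \<forall>X\<in>ops {..<d}. S i X = op_mult {..<d} (op_mult {..<d} (U i) X) (op_adj (U i))"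
    by blast
  \<comment> \<open>The state that arrives through \<open>C i\<close>; of it, the recovery uses only
    support and unit trace.\<close>
  define \<tau> where "\<tau> i = C i (op_unit 0 0)" for i
  have unit0: "op_unit 0 0 \<in> ops {..<h i}" "op_trace {..<h i} (op_unit 0 0) = 1" if "i \<in> {1..n}" for i
  proof -
    have "0 < h i" using h[OF that] by simp
    then show "op_unit 0 0 \<in> ops {..<h i}" by (simp add: op_unit_ops)
    have "op_trace {..<h i} (op_unit 0 0) = (\<Sum>j<h i. if j = 0 then 1 else 0)"
      unfolding op_trace_def op_unit_def by (intro sum.cong) auto
    then show "op_trace {..<h i} (op_unit 0 0) = 1" using \<open>0 < h i\<close> by simp
  qed
  have \<tau>: "\<tau> i \<in> ops {..<k i}" "(\<Sum>r<k i. \<tau> i r r) = 1" if "i \<in> {1..n}" for i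
    using C[OF that] unit0[OF that] linear_map_ops[of "{..<h i}" "{..<k i}" "C i" "op_unit 0 0"]
    by (auto simp: \<tau>_def channel_def cp_map_def op_trace_def)
  \<comment> \<open>Starting point of the recovery: nobody has measured and all phases are 1. One
    and the same encoded state takes this form for every \<open>x\<close>, so the encoder does not
    depend on the receiver.\<close>
  have state: "party_tensor {1..n} ?P ?N (copy_encoding d n h \<rho>)
      = residual_state \<tau> U n d x ({1..n} - {x}) (\<lambda>_. 1) \<rho>" if "x \<in> {1..n}" for x \<rho>
  proof -
    have encoding: "copy_encoding d n h \<rho> = product_sum {1..n} ({..<d} \<times> {..<d})
        (\<lambda>s. \<rho> (fst s) (snd s)) (\<lambda>s i. op_unit (0, fst s) (0, snd s))"
      by (rule copy_encoding_product_sum) (rule h)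
    have "party_tensor {1..n} ?P ?N (copy_encoding d n h \<rho>) = product_sum {1..n} ({..<d} \<times> {..<d})
        (\<lambda>s. \<rho> (fst s) (snd s)) (\<lambda>s i. ?N i (op_unit (0, fst s) (0, snd s)))"
      unfolding encoding
    proof (rule party_tensor_product_sum)
      show "linear_map (?P i) (?Q i) (?N i)" if "i \<in> {1..n}" for i
        using C[OF that] S[OF that] by (intro tensor_map_linear) (simp_all add: channel_def cp_map_def)
      show "op_unit (0, fst s) (0, snd s) \<in> ops (?P i)" if "s \<in> {..<d} \<times> {..<d}" "i \<in> {1..n}" for s i
        using that h[OF that(2)] by (intro op_unit_ops) auto
    qed auto
    also have "\<dots> = residual_state \<tau> U n d x ({1..n} - {x}) (\<lambda>_. 1) \<rho>"
      unfolding residual_state_def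
    proof (rule product_sum_cong)
      fix s f g assume s: "s \<in> {..<d} \<times> {..<d}"
      have "?N i (op_unit (0, fst s) (0, snd s)) u v = copy_state \<tau> U i s u v" if i: "i \<in> {1..n}" for i u v
      proof -
        have "?N i (op_unit (0, fst s) (0, snd s)) u v
            = C i (op_unit 0 0) (fst u) (fst v) * S i (op_unit (fst s) (snd s)) (snd u) (snd v)"
          by (rule tensor_map_unit) (use s h[OF i] in auto)
        also have "S i (op_unit (fst s) (snd s)) (snd u) (snd v) = U i (snd u) (fst s) * cnj (U i (snd v) (snd s))"
          by (rule noiseless_unit[OF U[OF i]]) (use s in auto)
        finally show ?thesis by (simp add: copy_state_def \<tau>_def)
      qed
      then show "\<rho> (fst s) (snd s) * (\<Prod>i\<in>{1..n}. ?N i (op_unit (0, fst s) (0, snd s)) (f i) (g i))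
        = \<rho> (fst s) (snd s) * (1 * cnj 1) * (\<Prod>i\<in>{1..n}. (if i \<in> {1..n} - insert x ({1..n} - {x})
            then op_unit (0, 0) (0, 0) else copy_state \<tau> U i s) (f i) (g i))"
        by (auto intro!: prod.cong)
    qed
    finally show ?thesis .
  qed
  show ?thesis
    unfolding rrqc_possible_def
  proof (intro exI[of _ "copy_encoding d n h"] conjI ballI)
    show "channel {..<d} (PiE {1..n} ?P) (copy_encoding d n h)"
      using assms(2) h by (rule copy_encoding_channel)
    fix x assume x: "x \<in> {1..n}"
    have Q: "residual_sys k n d x ({1..n} - {x}) = ?Q"
      by (auto simp: residual_sys_def fun_eq_iff)
    show "\<exists>\<Lambda>. locc {1..n} ?Q (output_sys d x) \<Lambda> \<and>
        (\<forall>\<rho>\<in>ops {..<d}. \<Lambda> (party_tensor {1..n} ?P ?N (copy_encoding d n h \<rho>)) = at_receiver n d x \<rho>)"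
      using locc_recover[of "{1..n} - {x}" n x d \<tau> k U "\<lambda>_. 1"] x assms(1) \<tau> U(1)
      unfolding Q state[OF x] by simp
  qed
qed

theorem theorem2:
  fixes d n :: nat
    and h k :: "nat \<Rightarrow> nat"
    and C S :: "nat \<Rightarrow> (nat, nat) superoper"
  assumes "1 \<le> d" and "2 \<le> n"
    and "\<And>i. i \<in> {1..n} \<Longrightarrow> 1 \<le> h i"
    and "\<And>i. i \<in> {1..n} \<Longrightarrow> 1 \<le> k i"
    and "\<And>i. i \<in> {1..n} \<Longrightarrow> entanglement_breaking {..<h i} {..<k i} (C i)"
    and "\<And>i. i \<in> {1..n} \<Longrightarrow> channel {..<d} {..<d} (S i)"
  shows "rrqc_possible d n (\<lambda>i. {..<h i} \<times> {..<d}) (\<lambda>i. {..<k i} \<times> {..<d})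
           (\<lambda>i. tensor_map {..<h i} {..<d} (C i) (S i))
         \<longleftrightarrow> (\<forall>i\<in>{1..n}. noiseless {..<d} (S i))"
proof
  assume possible: "rrqc_possible d n (\<lambda>i. {..<h i} \<times> {..<d}) (\<lambda>i. {..<k i} \<times> {..<d})
           (\<lambda>i. tensor_map {..<h i} {..<d} (C i) (S i))"
  show "\<forall>i\<in>{1..n}. noiseless {..<d} (S i)"
  proof
    fix x assume "x \<in> {1..n}"
    with assms(1,5,6) possible show "noiseless {..<d} (S x)"
      by (rule rrqc_possible_imp_noiseless)
  qed
next
  assume noiseless: "\<forall>i\<in>{1..n}. noiseless {..<d} (S i)"
  show "rrqc_possible d n (\<lambda>i. {..<h i} \<times> {..<d}) (\<lambda>i. {..<k i} \<times> {..<d})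
           (\<lambda>i. tensor_map {..<h i} {..<d} (C i) (S i))"
  proof (rule noiseless_imp_rrqc_possible)
    show "channel {..<h i} {..<k i} (C i)" if "i \<in> {1..n}" for i
      using assms(5)[OF that] by (simp add: entanglement_breaking_def)
    show "noiseless {..<d} (S i)" if "i \<in> {1..n}" for i
      using noiseless that by blast
  qed (use assms in auto)
qed

end
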